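(* Let $d \in \mathbb{N}$ and let $A \in \mathbb{R}^{d \times d}$ be a nonsingular matrix with spectral norm $\| A \|_2 < \frac{2\ln(2)}{\pi d^{3/2}}$. Let $\mathcal{C} := \mathbf{r}(A^{-T} \mathbb{Z}^d) \subseteq \mathbb{Z}^d$ be the set obtained by rounding each element of $A^{-T} \mathbb{Z}^d$ to its closest point in $\mathbb{Z}^d$. Then $\mathcal{E}(\mathcal{C})$ is a Riesz basis for $L^2(A [0,1]^d)$.
   Context: The spectral norm is $\|A\|_2 := \sup_{x \in \mathbb{R}^d, \|x\|_2 \le 1} \|Ax\|_2$. For a matrix $M \in \mathbb{R}^{d\times d}$ and a set $S \subseteq \mathbb{R}^d$, $M S := \{Mx : x \in S\}$, and $M^{-T} := (M^{-1})^T$. Rounding is coordinatewise "rounding half up": $\mathbf{r} : \mathbb{R}^d \to \mathbb{Z}^d$, $\mathbf{r}(x_1,\ldots,x_d) := (\lfloor x_1 + \tfrac12 \rfloor, \ldots, \lfloor x_d + \tfrac12 \rfloor)$, and for a set $S$, $\mathbf{r}(S) := \{\mathbf{r}(x) : x \in S\}$. For a discrete set $\Gamma \subseteq \mathbb{R}^d$, $\mathcal{E}(\Gamma) := \{ e^{2\pi i \gamma \cdot (\cdot)} : \gamma \in \Gamma\}$, regarded as a family of functions, indexed by $\Gamma$, on the domain under consideration. A countable family $\{f_n\}_{n \in I}$ in a separable Hilbert space $\mathcal{H}$ is a Riesz basis for $\mathcal{H}$ if its closed linear span is $\mathcal{H}$ and there are constants $0 < \alpha \le \beta < \infty$ such that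 $\alpha \sum_{n\in I} |c_n|^2 \le \| \sum_{n \in I} c_n f_n \|^2 \le \beta \sum_{n \in I} |c_n|^2$ for all $\{c_n\}_{n \in I} \in \ell_2(I)$. *)

theory Defs
  imports "HOL-Analysis.Analysis"
begin

lemma onorm_eq_SUP_cball:
  fixes A :: "real ^ 'n ^ 'n"
  shows "onorm ((*v) A) = (SUP x \<in> cball 0 1. norm (A *v x))"
proof (rule antisym)
  have bl: "bounded_linear ((*v) A)"
    by (simp add: matrix_vector_mul_bounded_linear)
  have le: "norm (A *v x) \<le> onorm ((*v) A)" if "x \<in> cball 0 1" for x
  proof -
    have "norm (A *v x) \<le> onorm ((*v) A) * norm x"
      by (rule onorm[OF bl])
    also have "\<dots> \<le> onorm ((*v) A)"
      using that onorm_pos_le[OF bl] by (simp add: mult_left_le)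
    finally show ?thesis .
  qed
  then have bdd: "bdd_above ((\<lambda>x. norm (A *v x)) ` cball 0 1)"
    by (auto intro!: bdd_aboveI2)
  show "(SUP x \<in> cball 0 1. norm (A *v x)) \<le> onorm ((*v) A)"
    by (rule cSUP_least) (use le in auto)
  show "onorm ((*v) A) \<le> (SUP x \<in> cball 0 1. norm (A *v x))"
    unfolding onorm_def
  proof (rule cSUP_least)
    fix x :: "real ^ 'n"
    have "norm (A *v x) / norm x = norm (A *v ((1 / norm x) *\<^sub>R x))"
      by (simp add: matrix_vector_mult_scaleR)
    also have "\<dots> \<le> (SUP x \<in> cball 0 1. norm (A *v x))"
      by (rule cSUP_upper[OF _ bdd]) simp
    finally show "norm (A *v x) / norm x \<le> (SUP x \<in> cball 0 1. norm (A *v x))" .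
  qed simp
qed

definition int_lattice :: "(real ^ 'n) set" where
  "int_lattice = {x. \<forall>i. x $ i \<in> \<int>}"

definition round_vec :: "real ^ 'n \<Rightarrow> real ^ 'n" where
  "round_vec x = (\<chi> i. of_int \<lfloor>x $ i + 1/2\<rfloor>)"

definition exponential :: "real ^ 'n \<Rightarrow> real ^ 'n \<Rightarrow> complex" where
  "exponential \<gamma> x = exp (2 * of_real pi * \<i> * of_real (\<gamma> \<bullet> x))"

text \<open>
  The Hilbert space \<open>L\<^sup>2(M)\<close> is represented by the square-integrable functions themselves,
  without passing to classes modulo equality almost everywhere; accordingly \<open>L2_norm\<close> is
  only a seminorm, and limits are unique only up to null sets. \<open>L2_norm M f\<close> is
  meaningful only for \<open>f \<in> L2_space M\<close>, since the integral of a
  non-integrable function is 0 by convention.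
\<close>

definition L2_space :: "'a measure \<Rightarrow> ('a \<Rightarrow> complex) set" where
  "L2_space M =
     {f. f \<in> borel_measurable M \<and> integrable M (\<lambda>x. (cmod (f x))\<^sup>2)}"

definition L2_norm :: "'a measure \<Rightarrow> ('a \<Rightarrow> complex) \<Rightarrow> real" where
  "L2_norm M f = sqrt (\<integral>x. (cmod (f x))\<^sup>2 \<partial>M)"

definition L2_closed_span ::
    "'a measure \<Rightarrow> ('i \<Rightarrow> 'a \<Rightarrow> complex) \<Rightarrow> 'i set \<Rightarrow> ('a \<Rightarrow> complex) set" where
  "L2_closed_span M f I =
     {g \<in> L2_space M. \<forall>e>0. \<exists>F c. finite F \<and> F \<subseteq> I \<and>
        L2_norm M (\<lambda>x. g x - (\<Sum>i\<in>F. c i * f i x)) < e}"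

text \<open>Unconditional convergence of \<open>\<Sum>i\<in>I. f i\<close> to \<open>h\<close> in \<open>L\<^sup>2(M)\<close>, as for \<^const>\<open>has_sum\<close>.\<close>

definition L2_has_sum ::
    "'a measure \<Rightarrow> ('i \<Rightarrow> 'a \<Rightarrow> complex) \<Rightarrow> ('a \<Rightarrow> complex) \<Rightarrow> 'i set \<Rightarrow> bool" where
  "L2_has_sum M f h I \<longleftrightarrow> h \<in> L2_space M \<and>
     ((\<lambda>F. L2_norm M (\<lambda>x. (\<Sum>i\<in>F. f i x) - h x)) \<longlongrightarrow> 0) (finite_subsets_at_top I)"

text \<open>
  The two-sided estimate for \<open>\<parallel>\<Sum>i\<in>I. c i * f i\<parallel>\<close> presupposes that the series converges
  in \<open>L\<^sup>2(M)\<close> for every square-summable \<open>c\<close>; this is made explicit by requiring its sum \<open>h\<close>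
  to exist.
\<close>

definition L2_Riesz_basis ::
    "'a measure \<Rightarrow> ('i \<Rightarrow> 'a \<Rightarrow> complex) \<Rightarrow> 'i set \<Rightarrow> bool" where
  "L2_Riesz_basis M f I \<longleftrightarrow>
     countable I \<and> (\<forall>i\<in>I. f i \<in> L2_space M) \<and>
     L2_closed_span M f I = L2_space M \<and>
     (\<exists>\<alpha> \<beta>. 0 < \<alpha> \<and> \<alpha> \<le> \<beta> \<and>
        (\<forall>c :: 'i \<Rightarrow> complex. (\<lambda>i. (cmod (c i))\<^sup>2) summable_on I \<longrightarrow>
           (\<exists>h. L2_has_sum M (\<lambda>i x. c i * f i x) h I \<and>
              \<alpha> * (\<Sum>\<^sub>\<infinity>i\<in>I. (cmod (c i))\<^sup>2) \<le> (L2_norm M h)\<^sup>2 \<and>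
              (L2_norm M h)\<^sup>2 \<le> \<beta> * (\<Sum>\<^sub>\<infinity>i\<in>I. (cmod (c i))\<^sup>2))))"

end

theory Submission
  imports Defs
begin

text \<open>
  Write \<open>S = A [0,1]\<^sup>d\<close>, \<open>B = A\<^sup>-\<^sup>1\<close> and \<open>\<mu> n = B\<^sup>T n\<close> for integer vectors \<open>n\<close>. The exponentials with
  frequencies \<open>\<mu> n\<close> are the characters \<open>x \<mapsto> exp (2 \<pi> \<i> n \<bullet> B x)\<close>; transported to the unit cube they
  are the Fourier basis, so on \<open>S\<close> they form a complete orthogonal system whose members all have
  squared norm \<open>|S|\<close>. Rounding replaces \<open>\<mu> n\<close> by \<open>\<mu> n + \<delta> n\<close>, where every coordinate of \<open>\<delta> n\<close> is at most
  1/2 in absolute value. The theorem says that this system survives such a change of frequencies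
  when \<open>S\<close> is small, and it is proved by the Paley-Wiener criterion
  (\<open>Paley_Wiener_stability\<close>): if every finite combination moves by at most \<open>q < 1\<close> times its norm,
  the new system is a Riesz basis, with the old bounds multiplied by \<open>(1 - q)\<^sup>2\<close> and \<open>(1 + q)\<^sup>2\<close>.

  The constant comes from expanding the perturbation in a power series around the centre \<open>z\<close> of
  \<open>S\<close>. Up to a unimodular factor independent of \<open>x\<close>, the old exponential is multiplied by
  \<open>exp (2 \<pi> \<i> \<delta> n \<bullet> (x - z))\<close>. In \<open>(\<delta> n \<bullet> (x - z))\<^sup>k\<close> the factors \<open>(x - z)\<^sub>j\<close> do not depend on \<open>n\<close> and
  are pulled out of the sum over \<open>n\<close>, while the factors \<open>(\<delta> n)\<^sub>j\<close> do not depend on \<open>x\<close> and are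
  absorbed into the coefficients. Each of the \<open>d\<close> coordinates therefore costs at most
  \<open>1/2 \<cdot> sup |(x - z)\<^sub>j| \<le> 1/2 \<cdot> \<parallel>A\<parallel> \<surd>d / 2\<close>, and the \<open>k\<close>-th term of the series costs at most \<open>s\<^sup>k / k!\<close> with
  \<open>s = \<pi> d \<surd>d \<parallel>A\<parallel> / 2\<close>. The total is \<open>q = exp s - 1\<close>, and \<open>q < 1\<close> is exactly the assumption
  \<open>s < ln 2\<close>. Centring matters: without it the coordinates of \<open>x\<close> could be twice as large.

  Two points need no change of variables. Orthogonality uses periodicity
  (\<open>integral_exponential_zero\<close>): a suitable shift of \<open>S\<close> changes the sign of the integral of a
  nontrivial character but, up to translating a slab by a period, does not change the domain. Completeness
  (\<open>exponentials_complete\<close>) combines the Stone-Weierstrass theorem on the torus with the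
  density in \<open>L\<^sup>2(S)\<close> of the continuous functions that vanish on the faces of \<open>S\<close>.

  Finally, distinct lattice points have distinct roundings because a Riesz basis cannot repeat a
  vector (\<open>L2_Riesz_basis_inj_on\<close>), so the family indexed by \<open>n\<close> is the family indexed by the
  rounded set (\<open>L2_Riesz_basis_image\<close>).
\<close>

section \<open>Square-integrable functions\<close>

lemma L2_norm_nonneg [simp]: "0 \<le> L2_norm M f"
  by (simp add: L2_norm_def)

lemma L2_norm_squared: "(L2_norm M f)\<^sup>2 = (\<integral>x. (cmod (f x))\<^sup>2 \<partial>M)"
  by (simp add: L2_norm_def)

lemma L2_norm_zero [simp]: "L2_norm M (\<lambda>x. 0) = 0"
  by (simp add: L2_norm_def)

lemma L2_space_measurable: "f \<in> L2_space M \<Longrightarrow> f \<in> borel_measurable M"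
  by (simp add: L2_space_def)

lemma L2_space_integrable: "f \<in> L2_space M \<Longrightarrow> integrable M (\<lambda>x. (cmod (f x))\<^sup>2)"
  by (simp add: L2_space_def)

lemma L2_space_zero [simp]: "(\<lambda>x. 0) \<in> L2_space M"
  by (simp add: L2_space_def)

lemma L2_norm_minus_commute: "L2_norm M (\<lambda>x. f x - g x) = L2_norm M (\<lambda>x. g x - f x)"
  by (simp add: L2_norm_def norm_minus_commute)

lemma L2_space_dominated:
  assumes f: "f \<in> L2_space M" and g: "g \<in> borel_measurable M"
    and le: "\<And>x. x \<in> space M \<Longrightarrow> cmod (g x) \<le> m * cmod (f x)"
  shows "g \<in> L2_space M"
proof -
  have "integrable M (\<lambda>x. (cmod (g x))\<^sup>2)"
  proof (rule Bochner_Integration.integrable_bound)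
    show "integrable M (\<lambda>x. m\<^sup>2 * (cmod (f x))\<^sup>2)"
      using f by (simp add: L2_space_def)
    show "AE x in M. norm ((cmod (g x))\<^sup>2) \<le> norm (m\<^sup>2 * (cmod (f x))\<^sup>2)"
      using power_mono[OF le] by (intro AE_I2) (simp add: power_mult_distrib)
  qed (use g in measurable)
  with g show ?thesis by (simp add: L2_space_def)
qed

lemma L2_norm_dominated:
  assumes f: "f \<in> L2_space M" and g: "g \<in> borel_measurable M" and "0 \<le> m"
    and le: "\<And>x. x \<in> space M \<Longrightarrow> cmod (g x) \<le> m * cmod (f x)"
  shows "L2_norm M g \<le> m * L2_norm M f"
proof -
  have "(\<integral>x. (cmod (g x))\<^sup>2 \<partial>M) \<le> (\<integral>x. m\<^sup>2 * (cmod (f x))\<^sup>2 \<partial>M)"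
  proof (rule integral_mono)
    show "integrable M (\<lambda>x. (cmod (g x))\<^sup>2)"
      by (rule L2_space_integrable[OF L2_space_dominated[OF f g le]])
    show "(cmod (g x))\<^sup>2 \<le> m\<^sup>2 * (cmod (f x))\<^sup>2" if "x \<in> space M" for x
      using power_mono[OF le[OF that], of 2] by (simp add: power_mult_distrib)
  qed (use f in \<open>simp add: L2_space_def\<close>)
  then have "(L2_norm M g)\<^sup>2 \<le> (m * L2_norm M f)\<^sup>2"
    by (simp add: L2_norm_squared power_mult_distrib)
  then show ?thesis
    by (rule power2_le_imp_le) (use \<open>0 \<le> m\<close> in simp)
qed

lemma L2_space_cmult [intro]: "f \<in> L2_space M \<Longrightarrow> (\<lambda>x. a * f x) \<in> L2_space M"
  by (rule L2_space_dominated[where m = "cmod a"])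
    (auto simp: norm_mult L2_space_def)

lemma L2_norm_cmult: "L2_norm M (\<lambda>x. a * f x) = cmod a * L2_norm M f"
  by (simp add: L2_norm_def norm_mult power_mult_distrib real_sqrt_mult)

lemma cmod_add_squared_le:
  assumes "t > 0"
  shows "(cmod (a + b))\<^sup>2 \<le> (1 + t) * (cmod a)\<^sup>2 + (1 + 1 / t) * (cmod b)\<^sup>2"
proof -
  have "(cmod (a + b))\<^sup>2 \<le> (cmod a + cmod b)\<^sup>2"
    by (intro power_mono norm_triangle_ineq) auto
  also have "\<dots> = (1 + t) * (cmod a)\<^sup>2 + (1 + 1 / t) * (cmod b)\<^sup>2
                   - (t * cmod a - cmod b)\<^sup>2 / t"
    using assms by (simp add: field_simps power2_eq_square)
  also have "\<dots> \<le> (1 + t) * (cmod a)\<^sup>2 + (1 + 1 / t) * (cmod b)\<^sup>2"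
    using assms by simp
  finally show ?thesis .
qed

lemma L2_space_add [intro]:
  assumes "f \<in> L2_space M" "g \<in> L2_space M"
  shows "(\<lambda>x. f x + g x) \<in> L2_space M"
proof -
  have [measurable]: "f \<in> borel_measurable M" "g \<in> borel_measurable M"
    using assms by (auto intro: L2_space_measurable)
  have "integrable M (\<lambda>x. (cmod (f x + g x))\<^sup>2)"
  proof (rule Bochner_Integration.integrable_bound)
    show "integrable M (\<lambda>x. 2 * (cmod (f x))\<^sup>2 + 2 * (cmod (g x))\<^sup>2)"
      using assms by (simp add: L2_space_def)
    show "AE x in M. norm ((cmod (f x + g x))\<^sup>2) \<le> norm (2 * (cmod (f x))\<^sup>2 + 2 * (cmod (g x))\<^sup>2)"
      using cmod_add_squared_le[of 1] by (intro AE_I2) simp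
  qed measurable
  moreover have "(\<lambda>x. f x + g x) \<in> borel_measurable M"
    using assms by (intro borel_measurable_add L2_space_measurable)
  ultimately show ?thesis by (simp add: L2_space_def)
qed

lemma L2_space_diff [intro]:
  "f \<in> L2_space M \<Longrightarrow> g \<in> L2_space M \<Longrightarrow> (\<lambda>x. f x - g x) \<in> L2_space M"
  using L2_space_add[OF _ L2_space_cmult[of g M "-1"]] by simp

lemma L2_space_sum [intro]:
  "(\<And>i. i \<in> F \<Longrightarrow> f i \<in> L2_space M) \<Longrightarrow> (\<lambda>x. \<Sum>i\<in>F. f i x) \<in> L2_space M"
  by (induction F rule: infinite_finite_induct) auto

text \<open>
  Minkowski's inequality. The weighted bound on \<open>|a + b|\<^sup>2\<close> is integrated and the weight \<open>t\<close> is then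
  chosen as the quotient of the two norms; both are first enlarged by \<open>\<epsilon>/2\<close>, so that the quotient
  makes sense when a norm vanishes.
\<close>

lemma L2_norm_add:
  assumes "f \<in> L2_space M" "g \<in> L2_space M"
  shows "L2_norm M (\<lambda>x. f x + g x) \<le> L2_norm M f + L2_norm M g"
proof (rule field_le_epsilon)
  fix \<epsilon> :: real assume "0 < \<epsilon>"
  define a where "a = L2_norm M f + \<epsilon> / 2"
  define b where "b = L2_norm M g + \<epsilon> / 2"
  have ab: "a > 0" "b > 0" "L2_norm M f \<le> a" "L2_norm M g \<le> b"
    using \<open>0 < \<epsilon>\<close> by (auto simp: a_def b_def add_nonneg_pos)
  have "(L2_norm M (\<lambda>x. f x + g x))\<^sup>2
      \<le> (\<integral>x. (1 + b / a) * (cmod (f x))\<^sup>2 + (1 + 1 / (b / a)) * (cmod (g x))\<^sup>2 \<partial>M)"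
    unfolding L2_norm_squared using assms ab L2_space_integrable[OF L2_space_add[OF assms]]
    by (intro integral_mono cmod_add_squared_le) (auto simp: L2_space_def)
  also have "\<dots> = (1 + b / a) * (L2_norm M f)\<^sup>2 + (1 + a / b) * (L2_norm M g)\<^sup>2"
    using assms by (simp add: L2_norm_squared L2_space_def)
  also have "\<dots> \<le> (1 + b / a) * a\<^sup>2 + (1 + a / b) * b\<^sup>2"
    using ab by (intro add_mono mult_left_mono power_mono) auto
  also have "\<dots> = (a + b)\<^sup>2"
    using ab by (simp add: field_simps power2_eq_square)
  finally have "L2_norm M (\<lambda>x. f x + g x) \<le> a + b"
    by (rule power2_le_imp_le) (use ab in simp)
  then show "L2_norm M (\<lambda>x. f x + g x) \<le> L2_norm M f + L2_norm M g + \<epsilon>"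
    by (simp add: a_def b_def)
qed

lemma L2_norm_triangle_diff:
  assumes "f \<in> L2_space M" "g \<in> L2_space M" "h \<in> L2_space M"
  shows "L2_norm M (\<lambda>x. f x - h x) \<le> L2_norm M (\<lambda>x. f x - g x) + L2_norm M (\<lambda>x. g x - h x)"
  using L2_norm_add[of "\<lambda>x. f x - g x" M "\<lambda>x. g x - h x"] assms
  by (simp add: L2_space_diff)

lemma L2_norm_triangle_sub:
  assumes "f \<in> L2_space M" "g \<in> L2_space M"
  shows "L2_norm M f - L2_norm M g \<le> L2_norm M (\<lambda>x. f x - g x)"
  using L2_norm_triangle_diff[OF assms L2_space_zero] by simp

lemma L2_norm_sum:
  assumes "\<And>i. i \<in> F \<Longrightarrow> f i \<in> L2_space M"
  shows "L2_norm M (\<lambda>x. \<Sum>i\<in>F. f i x) \<le> (\<Sum>i\<in>F. L2_norm M (f i))"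
  using assms
proof (induction F rule: infinite_finite_induct)
  case (insert a F)
  have "L2_norm M (\<lambda>x. \<Sum>i\<in>insert a F. f i x) \<le> L2_norm M (f a) + L2_norm M (\<lambda>x. \<Sum>i\<in>F. f i x)"
    using insert by (simp add: L2_norm_add L2_space_sum)
  with insert show ?case by fastforce
qed auto

text \<open>
  Fatou's lemma, in the form used both for completeness of \<open>L\<^sup>2\<close> and for summing the power series of
  the perturbation: norm bounds survive limits almost everywhere.
\<close>

lemma L2_norm_limit_le:
  assumes f: "\<And>n. f n \<in> L2_space M" and g: "g \<in> borel_measurable M"
    and lim: "AE x in M. (\<lambda>n. f n x) \<longlonglongrightarrow> g x"
    and le: "\<And>n. L2_norm M (f n) \<le> B"
  shows "g \<in> L2_space M" and "L2_norm M g \<le> B"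
proof -
  have "0 \<le> B"
    using le[of 0] L2_norm_nonneg[of M "f 0"] by linarith
  have "(\<integral>\<^sup>+x. ennreal ((cmod (g x))\<^sup>2) \<partial>M)
      = (\<integral>\<^sup>+x. liminf (\<lambda>n. ennreal ((cmod (f n x))\<^sup>2)) \<partial>M)"
  proof (rule nn_integral_cong_AE, use lim in eventually_elim)
    case (elim x)
    then have "(\<lambda>n. ennreal ((cmod (f n x))\<^sup>2)) \<longlonglongrightarrow> ennreal ((cmod (g x))\<^sup>2)"
      by (intro tendsto_intros)
    then have "liminf (\<lambda>n. ennreal ((cmod (f n x))\<^sup>2)) = ennreal ((cmod (g x))\<^sup>2)"
      by (intro lim_imp_Liminf) auto
    then show ?case
      by (rule sym)
  qed
  also have "\<dots> \<le> liminf (\<lambda>n. \<integral>\<^sup>+x. ennreal ((cmod (f n x))\<^sup>2) \<partial>M)"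
    using f by (intro nn_integral_liminf) (auto simp: L2_space_def)
  also have "\<dots> \<le> ennreal (B\<^sup>2)"
  proof -
    have "(\<integral>\<^sup>+x. ennreal ((cmod (f n x))\<^sup>2) \<partial>M) \<le> ennreal (B\<^sup>2)" for n
      using L2_space_integrable[OF f, of n] le[of n]
      by (subst nn_integral_eq_integral)
        (auto simp flip: L2_norm_squared intro!: ennreal_leI power_mono)
    then have "liminf (\<lambda>n. \<integral>\<^sup>+x. ennreal ((cmod (f n x))\<^sup>2) \<partial>M) \<le> liminf (\<lambda>n::nat. ennreal (B\<^sup>2))"
      by (intro Liminf_mono always_eventually allI)
    then show ?thesis by (simp add: Liminf_const)
  qed
  finally have nn: "(\<integral>\<^sup>+x. ennreal ((cmod (g x))\<^sup>2) \<partial>M) \<le> ennreal (B\<^sup>2)" .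
  have "integrable M (\<lambda>x. (cmod (g x))\<^sup>2)"
    using nn g by (intro integrableI_bounded) (auto simp: less_top[symmetric] top_unique)
  then show g2: "g \<in> L2_space M"
    using g by (simp add: L2_space_def)
  have "ennreal ((L2_norm M g)\<^sup>2) \<le> ennreal (B\<^sup>2)"
    using nn L2_space_integrable[OF g2] by (simp add: L2_norm_squared nn_integral_eq_integral)
  then show "L2_norm M g \<le> B"
    using \<open>0 \<le> B\<close> by (auto intro: power2_le_imp_le)
qed

text \<open>
  Only some bound of the \<open>L\<^sup>1\<close> norm by the \<open>L\<^sup>2\<close> norm is needed. The crude constant comes from
  \<open>|z| \<le> a/2 + |z|\<^sup>2/(2a)\<close> with \<open>a\<close> close to the \<open>L\<^sup>2\<close> norm, which avoids the Cauchy-Schwarz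
  inequality.
\<close>

lemma (in finite_measure) L2_imp_L1:
  assumes "f \<in> L2_space M"
  shows "integrable M f" "(\<integral>x. cmod (f x) \<partial>M) \<le> (measure M (space M) + 1) * L2_norm M f"
proof -
  show i: "integrable M f"
  proof (rule Bochner_Integration.integrable_bound)
    show "integrable M (\<lambda>x. 1 + (cmod (f x))\<^sup>2)"
      using assms by (simp add: L2_space_def)
    show "AE x in M. norm (f x) \<le> norm (1 + (cmod (f x))\<^sup>2)"
    proof (rule AE_I2)
      fix x
      have "0 \<le> (cmod (f x) - 1)\<^sup>2" by simp
      then have "2 * cmod (f x) \<le> 1 + (cmod (f x))\<^sup>2"
        by (simp add: power2_diff)
      then have "cmod (f x) \<le> 1 + (cmod (f x))\<^sup>2"
        using norm_ge_zero[of "f x"] by linarith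
      then show "norm (f x) \<le> norm (1 + (cmod (f x))\<^sup>2)"
        by simp
    qed
  qed (use assms in \<open>simp add: L2_space_def\<close>)
  show "(\<integral>x. cmod (f x) \<partial>M) \<le> (measure M (space M) + 1) * L2_norm M f"
  proof (rule field_le_epsilon)
    fix \<epsilon> :: real assume "0 < \<epsilon>"
    define m where "m = measure M (space M) + 1"
    define a where "a = L2_norm M f + \<epsilon> / m"
    have m: "m \<ge> 1" by (simp add: m_def)
    then have a: "a > 0" "L2_norm M f \<le> a"
      using \<open>0 < \<epsilon>\<close> by (auto simp: a_def add_nonneg_pos)
    have "(\<integral>x. cmod (f x) \<partial>M) \<le> (\<integral>x. a / 2 + (cmod (f x))\<^sup>2 * (1 / (2 * a)) \<partial>M)"
    proof (rule integral_mono)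
      fix x
      have "0 \<le> (cmod (f x) - a)\<^sup>2 / (2 * a)" using a by simp
      also have "\<dots> = a / 2 + (cmod (f x))\<^sup>2 * (1 / (2 * a)) - cmod (f x)"
        using a by (simp add: field_simps power2_eq_square)
      finally show "cmod (f x) \<le> a / 2 + (cmod (f x))\<^sup>2 * (1 / (2 * a))" by simp
    qed (use assms i in \<open>auto simp: L2_space_def\<close>)
    also have "\<dots> = (m - 1) * a / 2 + (L2_norm M f)\<^sup>2 / (2 * a)"
      using assms by (simp add: L2_space_def L2_norm_squared m_def)
    also have "\<dots> \<le> (m - 1) * a / 2 + a\<^sup>2 / (2 * a)"
      using a by (intro add_left_mono divide_right_mono power_mono) auto
    also have "\<dots> = m * a / 2"
      using a by (simp add: field_simps power2_eq_square)
    also have "\<dots> \<le> m * a"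
      using a m by simp
    also have "\<dots> = m * L2_norm M f + \<epsilon>"
      using m by (simp add: a_def field_simps)
    finally show "(\<integral>x. cmod (f x) \<partial>M) \<le> (measure M (space M) + 1) * L2_norm M f + \<epsilon>"
      by (simp add: m_def)
  qed
qed

text \<open>
  The Riesz-Fischer theorem for sequences with geometrically small increments: the increments are
  summable in \<open>L\<^sup>1\<close>, so the sequence converges almost everywhere, and Fatou's lemma turns the
  pointwise limit into a limit in norm.
\<close>

lemma (in finite_measure) L2_complete_geometric:
  assumes f: "\<And>n. f n \<in> L2_space M"
    and le: "\<And>m n. m \<le> n \<Longrightarrow> L2_norm M (\<lambda>x. f n x - f m x) \<le> B * (1/2)^m"
  obtains h where "h \<in> L2_space M" "\<And>m. L2_norm M (\<lambda>x. f m x - h x) \<le> B * (1/2)^m"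
proof -
  let ?d = "\<lambda>n x. f (Suc n) x - f n x"
  have [measurable]: "f n \<in> borel_measurable M" for n
    using f by (simp add: L2_space_def)
  have d2: "?d n \<in> L2_space M" for n
    using f by (intro L2_space_diff) 
  have "(\<integral>\<^sup>+x. (\<Sum>n. ennreal (cmod (?d n x))) \<partial>M) = (\<Sum>n. \<integral>\<^sup>+x. ennreal (cmod (?d n x)) \<partial>M)"
    by (intro nn_integral_suminf) measurable
  also have "\<dots> \<le> (\<Sum>n. ennreal ((measure M (space M) + 1) * (B * (1/2)^n)))"
  proof (intro suminf_le summableI)
    fix n
    have "(\<integral>\<^sup>+x. ennreal (cmod (?d n x)) \<partial>M) = ennreal (\<integral>x. cmod (?d n x) \<partial>M)"
      using L2_imp_L1(1)[OF d2, of n] by (intro nn_integral_eq_integral) auto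
    also have "\<dots> \<le> ennreal ((measure M (space M) + 1) * (B * (1/2)^n))"
    proof (rule ennreal_leI, rule order_trans[OF L2_imp_L1(2)[OF d2]], rule mult_left_mono)
      show "L2_norm M (?d n) \<le> B * (1/2)^n"
        by (rule le) simp
    qed simp
    finally show "(\<integral>\<^sup>+x. ennreal (cmod (?d n x)) \<partial>M) \<le> ennreal ((measure M (space M) + 1) * (B * (1/2)^n))" .
  qed
  also have "\<dots> < \<infinity>"
  proof -
    have "0 \<le> B"
      using le[of 0 0] L2_norm_nonneg[of M "\<lambda>x. f 0 x - f 0 x"] by simp
    moreover have "summable (\<lambda>n. (measure M (space M) + 1) * (B * (1/2)^n))"
      by (intro summable_mult summable_geometric) simp
    ultimately show ?thesis
      by (subst suminf_ennreal2) auto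
  qed
  finally have "AE x in M. (\<Sum>n. ennreal (cmod (?d n x))) \<noteq> \<infinity>"
    by (intro nn_integral_PInf_AE) auto
  then have conv: "AE x in M. convergent (\<lambda>n. f n x)"
  proof eventually_elim
    case (elim x)
    then have "summable (\<lambda>n. cmod (?d n x))"
      by (intro summable_suminf_not_top) auto
    then have "summable (\<lambda>n. ?d n x)"
      by (rule summable_norm_cancel)
    then show ?case
      using summable_iff_convergent[of "\<lambda>n. ?d n x"] 
      using sum_lessThan_telescope[of "\<lambda>n. f n x"]
      by (simp add: convergent_diff_const_right_iff)
  qed
  define h where "h = (\<lambda>x. lim (\<lambda>n. f n x))"
  have [measurable]: "h \<in> borel_measurable M"
    unfolding h_def by measurable
  have lim: "AE x in M. (\<lambda>n. f n x) \<longlonglongrightarrow> h x"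
    using conv by eventually_elim (simp add: h_def convergent_LIMSEQ_iff)
  have tail: "(\<lambda>x. f m x - h x) \<in> L2_space M \<and> L2_norm M (\<lambda>x. f m x - h x) \<le> B * (1/2)^m" for m
  proof -
    have 1: "(\<lambda>x. f m x - f (n + m) x) \<in> L2_space M" for n
      using f by auto
    have 2: "AE x in M. (\<lambda>n. f m x - f (n + m) x) \<longlonglongrightarrow> f m x - h x"
      using lim by eventually_elim (intro tendsto_intros LIMSEQ_ignore_initial_segment)
    have 3: "L2_norm M (\<lambda>x. f m x - f (n + m) x) \<le> B * (1/2)^m" for n
      using le[of m "n + m"] L2_norm_minus_commute[of M "f m"] by simp
    have 4: "(\<lambda>x. f m x - h x) \<in> borel_measurable M" by measurable
    show ?thesis using L2_norm_limit_le[OF 1 4 2 3] by blast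
  qed
  have "(\<lambda>x. f 0 x - (f 0 x - h x)) \<in> L2_space M"
    by (rule L2_space_diff[OF f]) (use tail in blast)
  then have "h \<in> L2_space M" by simp
  with tail that show ?thesis by blast
qed

lemma L2_norm_dominated_convergence:
  assumes d: "\<And>n. d n \<in> borel_measurable M" and lim: "AE x in M. (\<lambda>n. d n x) \<longlonglongrightarrow> 0"
    and w: "integrable M (\<lambda>x. (w x)\<^sup>2)" and le: "\<And>n. AE x in M. cmod (d n x) \<le> w x"
  shows "(\<lambda>n. L2_norm M (d n)) \<longlonglongrightarrow> 0"
proof -
  have [measurable]: "d n \<in> borel_measurable M" for n by (rule d)
  have "(\<lambda>n. \<integral>x. (cmod (d n x))\<^sup>2 \<partial>M) \<longlonglongrightarrow> (\<integral>x. 0 \<partial>M)"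
  proof (rule integral_dominated_convergence[OF _ _ w])
    show "AE x in M. (\<lambda>n. (cmod (d n x))\<^sup>2) \<longlonglongrightarrow> 0"
      using lim
    proof eventually_elim
      case (elim x)
      then have "(\<lambda>n. (cmod (d n x))\<^sup>2) \<longlonglongrightarrow> (cmod 0)\<^sup>2"
        by (intro tendsto_intros)
      then show ?case by simp
    qed
    show "AE x in M. norm ((cmod (d n x))\<^sup>2) \<le> (w x)\<^sup>2" for n
      using le[of n] by eventually_elim (simp add: power_mono)
  qed auto
  then have "(\<lambda>n. sqrt (\<integral>x. (cmod (d n x))\<^sup>2 \<partial>M)) \<longlonglongrightarrow> sqrt 0"
    by (intro tendsto_real_sqrt) simp
  then show ?thesis by (simp add: L2_norm_def)
qed

lemma LIMSEQ_zero_ex_less: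
  fixes a :: "nat \<Rightarrow> real"
  assumes "a \<longlonglongrightarrow> 0" "0 < e"
  obtains n where "a n < e"
  using order_tendstoD(2)[OF assms] by (auto simp: eventually_sequentially)

lemma L2_approx_bounded:
  assumes f: "f \<in> L2_space M" and "0 < e"
  obtains k :: nat and g where "g \<in> L2_space M" "\<And>x. cmod (g x) \<le> k" "L2_norm M (\<lambda>x. f x - g x) < e"
proof -
  have [measurable]: "f \<in> borel_measurable M"
    using f by (rule L2_space_measurable)
  define g where "g k x = (if cmod (f x) \<le> real k then f x else 0)" for k x
  have [measurable]: "g k \<in> borel_measurable M" for k
    unfolding g_def by measurable
  have "(\<lambda>k. L2_norm M (\<lambda>x. f x - g k x)) \<longlonglongrightarrow> 0"
  proof (rule L2_norm_dominated_convergence[OF _ _ L2_space_integrable[OF f]])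
    show "AE x in M. (\<lambda>k. f x - g k x) \<longlonglongrightarrow> 0"
    proof (rule AE_I2)
      fix x
      have "\<forall>\<^sub>F k in sequentially. f x - g k x = 0"
        using eventually_ge_at_top[of "nat \<lceil>cmod (f x)\<rceil>"]
        by eventually_elim (auto simp: g_def nat_le_iff ceiling_le_iff)
      then show "(\<lambda>k. f x - g k x) \<longlonglongrightarrow> 0"
        by (rule tendsto_eventually)
    qed
    show "AE x in M. cmod (f x - g k x) \<le> cmod (f x)" for k
      by (rule AE_I2) (simp add: g_def)
  qed measurable
  then obtain k where "L2_norm M (\<lambda>x. f x - g k x) < e"
    using LIMSEQ_zero_ex_less \<open>0 < e\<close> by blast
  moreover have "g k \<in> L2_space M"
    by (rule L2_space_dominated[OF f, where m = 1]) (auto simp: g_def)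
  moreover have "cmod (g k x) \<le> k" for x
    by (simp add: g_def)
  ultimately show ?thesis using that by blast
qed

section \<open>Riesz bases and their stability\<close>

lemma tail_of_summable_nonneg:
  fixes a :: "'i \<Rightarrow> real"
  assumes a: "a summable_on I" and nn: "\<And>i. i \<in> I \<Longrightarrow> 0 \<le> a i" and "0 < \<epsilon>"
  obtains F where "finite F" "F \<subseteq> I" "\<And>G. finite G \<Longrightarrow> G \<subseteq> I - F \<Longrightarrow> sum a G \<le> \<epsilon>"
proof -
  obtain F where F: "finite F" "F \<subseteq> I" "dist (sum a F) (infsum a I) \<le> \<epsilon>"
    using has_sum_finite_approximation[OF has_sum_infsum[OF a] \<open>0 < \<epsilon>\<close>] by blast
  have "sum a G \<le> \<epsilon>" if G: "finite G" "G \<subseteq> I - F" for G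
  proof -
    have "sum a (F \<union> G) \<le> infsum a I"
      using F G nn by (intro finite_sum_le_infsum a) auto
    also have "sum a (F \<union> G) = sum a F + sum a G"
      using F G by (intro sum.union_disjoint) auto
    finally show ?thesis
      using F(3) by (simp add: dist_real_def)
  qed
  with F that show ?thesis by blast
qed

text \<open>
  The upper bound for finite sums makes the net of finite partial sums Cauchy. It is enough to follow it
  along an increasing sequence of finite sets whose complements carry at most \<open>4\<^sup>-\<^sup>m\<close> of the mass
  of the coefficients.
\<close>

lemma (in finite_measure) L2_has_sum_exists:
  assumes f: "\<And>i. i \<in> I \<Longrightarrow> f i \<in> L2_space M" and "0 \<le> \<beta>"
    and upper: "\<And>F. finite F \<Longrightarrow> F \<subseteq> I \<Longrightarrow>
        (L2_norm M (\<lambda>x. \<Sum>i\<in>F. c i * f i x))\<^sup>2 \<le> \<beta> * (\<Sum>i\<in>F. (cmod (c i))\<^sup>2)"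
    and c: "(\<lambda>i. (cmod (c i))\<^sup>2) summable_on I"
  obtains h where "L2_has_sum M (\<lambda>i x. c i * f i x) h I"
proof -
  let ?S = "\<lambda>F x. \<Sum>i\<in>F. c i * f i x"
  have "\<exists>F. finite F \<and> F \<subseteq> I \<and>
      (\<forall>G. finite G \<longrightarrow> G \<subseteq> I - F \<longrightarrow> (\<Sum>i\<in>G. (cmod (c i))\<^sup>2) \<le> (1/4)^m)" for m :: nat
    by (rule tail_of_summable_nonneg[OF c, of "(1/4)^m"]) auto
  then obtain F where F: "\<And>m. finite (F m)" "\<And>m. F m \<subseteq> I"
    and tail: "\<And>m G. finite G \<Longrightarrow> G \<subseteq> I - F m \<Longrightarrow> (\<Sum>i\<in>G. (cmod (c i))\<^sup>2) \<le> (1/4)^m"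
    by metis
  define K where "K n = (\<Union>k\<le>n. F k)" for n :: nat
  have K: "finite (K n)" "K n \<subseteq> I" "F n \<subseteq> K n" for n
    using F by (auto simp: K_def)
  have K_mono: "K m \<subseteq> K n" if "m \<le> n" for m n
    using that by (fastforce simp: K_def)
  have S2: "?S G \<in> L2_space M" if "G \<subseteq> I" for G
    using that f by (intro L2_space_sum L2_space_cmult) auto
  have cauchy: "L2_norm M (\<lambda>x. ?S G x - ?S (K m) x) \<le> sqrt \<beta> * (1/2)^m"
    if G: "finite G" "K m \<subseteq> G" "G \<subseteq> I" for G m
  proof -
    have "L2_norm M (\<lambda>x. ?S G x - ?S (K m) x) = L2_norm M (?S (G - K m))"
      using G by (simp add: sum_diff)
    also have "\<dots> \<le> sqrt \<beta> * (1/2)^m"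
    proof (rule power2_le_imp_le)
      have "(L2_norm M (?S (G - K m)))\<^sup>2 \<le> \<beta> * (\<Sum>i\<in>G - K m. (cmod (c i))\<^sup>2)"
        using G by (intro upper) auto
      also have "\<dots> \<le> \<beta> * (1/4)^m"
        using G K(3)[of m] \<open>0 \<le> \<beta>\<close> by (intro mult_left_mono tail) auto
      also have "\<dots> = (sqrt \<beta> * (1/2)^m)\<^sup>2"
        using \<open>0 \<le> \<beta>\<close>
        by (simp add: power_mult_distrib power_divide power2_eq_square flip: power_mult_distrib)
      finally show "(L2_norm M (?S (G - K m)))\<^sup>2 \<le> (sqrt \<beta> * (1/2)^m)\<^sup>2" .
    qed (use \<open>0 \<le> \<beta>\<close> in simp)
    finally show ?thesis .
  qed
  obtain h where h: "h \<in> L2_space M"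
    and lim: "\<And>m. L2_norm M (\<lambda>x. ?S (K m) x - h x) \<le> sqrt \<beta> * (1/2)^m"
    by (rule L2_complete_geometric[of "\<lambda>n. ?S (K n)" "sqrt \<beta>"]) (use S2 K cauchy K_mono in auto)
  have "((\<lambda>G. L2_norm M (\<lambda>x. ?S G x - h x)) \<longlongrightarrow> 0) (finite_subsets_at_top I)"
  proof (rule tendstoI)
    fix e :: real assume "0 < e"
    have "(\<lambda>m. 2 * sqrt \<beta> * (1/2)^m) \<longlonglongrightarrow> 2 * sqrt \<beta> * 0"
      by (intro tendsto_intros LIMSEQ_power_zero) auto
    then have "eventually (\<lambda>m. 2 * sqrt \<beta> * (1/2)^m < e) sequentially"
      using \<open>0 < e\<close> by (intro order_tendstoD(2)[where a = e]) auto
    then obtain m where m: "2 * sqrt \<beta> * (1/2)^m < e"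
      by (auto simp: eventually_sequentially)
    have "L2_norm M (\<lambda>x. ?S G x - h x) < e" if G: "finite G" "K m \<subseteq> G" "G \<subseteq> I" for G
    proof -
      have "L2_norm M (\<lambda>x. ?S G x - h x)
          \<le> L2_norm M (\<lambda>x. ?S G x - ?S (K m) x) + L2_norm M (\<lambda>x. ?S (K m) x - h x)"
        using G K h S2 by (intro L2_norm_triangle_diff) auto
      also have "\<dots> \<le> sqrt \<beta> * (1/2)^m + sqrt \<beta> * (1/2)^m"
        using G by (intro add_mono cauchy lim)
      finally show ?thesis using m by simp
    qed
    then show "\<forall>\<^sub>F G in finite_subsets_at_top I. dist (L2_norm M (\<lambda>x. ?S G x - h x)) 0 < e"
      using K unfolding eventually_finite_subsets_at_top
      by (intro exI[of _ "K m"]) auto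
  qed
  with h that show ?thesis by (simp add: L2_has_sum_def)
qed

lemma L2_has_sum_norm:
  assumes f: "\<And>i. i \<in> I \<Longrightarrow> f i \<in> L2_space M" and h: "L2_has_sum M f h I"
  shows "((\<lambda>F. L2_norm M (\<lambda>x. \<Sum>i\<in>F. f i x)) \<longlongrightarrow> L2_norm M h) (finite_subsets_at_top I)"
proof (rule Lim_transform2)
  show "((\<lambda>F. L2_norm M h) \<longlongrightarrow> L2_norm M h) (finite_subsets_at_top I)"
    by (rule tendsto_const)
  have h2: "h \<in> L2_space M"
    using h by (simp add: L2_has_sum_def)
  show "((\<lambda>F. L2_norm M h - L2_norm M (\<lambda>x. \<Sum>i\<in>F. f i x)) \<longlongrightarrow> 0) (finite_subsets_at_top I)"
  proof (rule Lim_null_comparison)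
    show "((\<lambda>F. L2_norm M (\<lambda>x. (\<Sum>i\<in>F. f i x) - h x)) \<longlongrightarrow> 0) (finite_subsets_at_top I)"
      using h by (simp add: L2_has_sum_def)
    show "\<forall>\<^sub>F F in finite_subsets_at_top I.
        norm (L2_norm M h - L2_norm M (\<lambda>x. \<Sum>i\<in>F. f i x)) \<le> L2_norm M (\<lambda>x. (\<Sum>i\<in>F. f i x) - h x)"
    proof (rule eventually_finite_subsets_at_top_weakI)
      fix F assume "finite F" "F \<subseteq> I"
      then have F2: "(\<lambda>x. \<Sum>i\<in>F. f i x) \<in> L2_space M"
        using f by auto
      show "norm (L2_norm M h - L2_norm M (\<lambda>x. \<Sum>i\<in>F. f i x)) \<le> L2_norm M (\<lambda>x. (\<Sum>i\<in>F. f i x) - h x)"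
        using L2_norm_triangle_sub[OF F2 h2] L2_norm_triangle_sub[OF h2 F2]
          L2_norm_minus_commute[of M h "\<lambda>x. \<Sum>i\<in>F. f i x"] by simp
    qed
  qed
qed

text \<open>
  Both frame bounds are closed conditions, so they only have to be checked on finite sums.
\<close>

lemma (in finite_measure) L2_Riesz_basis_of_finite_sums:
  assumes I: "countable I" and f: "\<And>i. i \<in> I \<Longrightarrow> f i \<in> L2_space M"
    and span: "L2_closed_span M f I = L2_space M" and \<alpha>\<beta>: "0 < \<alpha>" "\<alpha> \<le> \<beta>"
    and lower: "\<And>F c. finite F \<Longrightarrow> F \<subseteq> I \<Longrightarrow>
        \<alpha> * (\<Sum>i\<in>F. (cmod (c i))\<^sup>2) \<le> (L2_norm M (\<lambda>x. \<Sum>i\<in>F. c i * f i x))\<^sup>2"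
    and upper: "\<And>F c. finite F \<Longrightarrow> F \<subseteq> I \<Longrightarrow>
        (L2_norm M (\<lambda>x. \<Sum>i\<in>F. c i * f i x))\<^sup>2 \<le> \<beta> * (\<Sum>i\<in>F. (cmod (c i))\<^sup>2)"
  shows "L2_Riesz_basis M f I"
proof -
  have "\<exists>h. L2_has_sum M (\<lambda>i x. c i * f i x) h I \<and>
           \<alpha> * (\<Sum>\<^sub>\<infinity>i\<in>I. (cmod (c i))\<^sup>2) \<le> (L2_norm M h)\<^sup>2 \<and>
           (L2_norm M h)\<^sup>2 \<le> \<beta> * (\<Sum>\<^sub>\<infinity>i\<in>I. (cmod (c i))\<^sup>2)"
    if c: "(\<lambda>i. (cmod (c i))\<^sup>2) summable_on I" for c
  proof -
    obtain h where h: "L2_has_sum M (\<lambda>i x. c i * f i x) h I"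
      by (rule L2_has_sum_exists[OF f _ upper c]) (use \<alpha>\<beta> in auto)
    have lim_norm: "((\<lambda>F. (L2_norm M (\<lambda>x. \<Sum>i\<in>F. c i * f i x))\<^sup>2) \<longlongrightarrow> (L2_norm M h)\<^sup>2)
        (finite_subsets_at_top I)"
      using f by (intro tendsto_power L2_has_sum_norm[OF _ h]) auto
    have lim_c: "((\<lambda>F. a * (\<Sum>i\<in>F. (cmod (c i))\<^sup>2)) \<longlongrightarrow> a * (\<Sum>\<^sub>\<infinity>i\<in>I. (cmod (c i))\<^sup>2))
        (finite_subsets_at_top I)" for a
      by (intro tendsto_mult_left infsum_tendsto c)
    have "\<alpha> * (\<Sum>\<^sub>\<infinity>i\<in>I. (cmod (c i))\<^sup>2) \<le> (L2_norm M h)\<^sup>2"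
      using lower by (intro tendsto_le[OF _ lim_norm lim_c] eventually_finite_subsets_at_top_weakI) auto
    moreover have "(L2_norm M h)\<^sup>2 \<le> \<beta> * (\<Sum>\<^sub>\<infinity>i\<in>I. (cmod (c i))\<^sup>2)"
      using upper by (intro tendsto_le[OF _ lim_c lim_norm] eventually_finite_subsets_at_top_weakI) auto
    ultimately show ?thesis using h by blast
  qed
  then show ?thesis
    unfolding L2_Riesz_basis_def using assms by blast
qed

definition finite_combs :: "('i \<Rightarrow> 'a \<Rightarrow> complex) \<Rightarrow> 'i set \<Rightarrow> ('a \<Rightarrow> complex) set" where
  "finite_combs f I = {p. \<exists>F c. finite F \<and> F \<subseteq> I \<and> p = (\<lambda>x. \<Sum>i\<in>F. c i * f i x)}"

lemma finite_combsI: "finite F \<Longrightarrow> F \<subseteq> I \<Longrightarrow> (\<lambda>x. \<Sum>i\<in>F. c i * f i x) \<in> finite_combs f I"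
  by (auto simp: finite_combs_def)

lemma finite_combs_single: "i \<in> I \<Longrightarrow> (\<lambda>x. a * f i x) \<in> finite_combs f I"
  using finite_combsI[of "{i}" I "\<lambda>_. a" f] by simp

lemma finite_combs_add:
  assumes "p \<in> finite_combs f I" "r \<in> finite_combs f I"
  shows "(\<lambda>x. p x + r x) \<in> finite_combs f I"
proof -
  obtain F c G a where F: "finite F" "F \<subseteq> I" "p = (\<lambda>x. \<Sum>i\<in>F. c i * f i x)"
    and G: "finite G" "G \<subseteq> I" "r = (\<lambda>x. \<Sum>i\<in>G. a i * f i x)"
    using assms unfolding finite_combs_def by blast
  define d where "d i = (if i \<in> F then c i else 0) + (if i \<in> G then a i else 0)" for i
  have ext: "(\<Sum>i\<in>F \<union> G. (if i \<in> H then z i else 0) * f i x) = (\<Sum>i\<in>H. z i * f i x)"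
    if "H \<subseteq> F \<union> G" for H z x
    using that F G by (intro sum.mono_neutral_cong_right) auto
  have "p x + r x = (\<Sum>i\<in>F \<union> G. d i * f i x)" for x
    unfolding d_def distrib_right sum.distrib using F G by (simp add: ext)
  then show ?thesis
    using F G finite_combsI[of "F \<union> G" I d f] by simp
qed

lemma finite_combs_sum:
  "(\<And>k. k \<in> K \<Longrightarrow> p k \<in> finite_combs f I) \<Longrightarrow> (\<lambda>x. \<Sum>k\<in>K. p k x) \<in> finite_combs f I"
proof (induction K rule: infinite_finite_induct)
  case (insert k K)
  then show ?case using finite_combs_add[of "p k" f I "\<lambda>x. \<Sum>k\<in>K. p k x"] by simp
qed (use finite_combsI[of "{}"] in auto)

lemma L2_closed_span_eq:
  "L2_closed_span M f I = {g \<in> L2_space M. \<forall>e>0. \<exists>p\<in>finite_combs f I. L2_norm M (\<lambda>x. g x - p x) < e}"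
  unfolding L2_closed_span_def finite_combs_def by fastforce

text \<open>
  Approximating \<open>g\<close> by a combination of the \<open>b i\<close> and replacing each \<open>b i\<close> by \<open>f i\<close> leaves an
  error of about \<open>q \<cdot> \<parallel>g\<parallel>\<close>. Repeating this with the error in place of \<open>g\<close> gives errors \<open>q\<^sup>k \<cdot> \<parallel>g\<parallel>\<close>,
  which tend to 0.
\<close>

lemma L2_closed_span_perturbed:
  assumes f: "\<And>i. i \<in> I \<Longrightarrow> f i \<in> L2_space M" and b: "\<And>i. i \<in> I \<Longrightarrow> b i \<in> L2_space M"
    and span: "L2_closed_span M b I = L2_space M" and q: "0 \<le> q" "q < 1"
    and close: "\<And>F c. finite F \<Longrightarrow> F \<subseteq> I \<Longrightarrow>
        L2_norm M (\<lambda>x. \<Sum>i\<in>F. c i * (f i x - b i x)) \<le> q * L2_norm M (\<lambda>x. \<Sum>i\<in>F. c i * b i x)"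
  shows "L2_closed_span M f I = L2_space M"
proof -
  have step: "\<exists>F c. finite F \<and> F \<subseteq> I \<and>
      L2_norm M (\<lambda>x. g x - (\<Sum>i\<in>F. c i * f i x)) \<le> q * L2_norm M g + \<epsilon>"
    if g: "g \<in> L2_space M" and "0 < \<epsilon>" for g \<epsilon>
  proof -
    have "g \<in> L2_closed_span M b I" "0 < \<epsilon> / 2"
      using g \<open>0 < \<epsilon>\<close> by (simp_all add: span)
    then obtain F c where F: "finite F" "F \<subseteq> I"
      and gF: "L2_norm M (\<lambda>x. g x - (\<Sum>i\<in>F. c i * b i x)) < \<epsilon> / 2"
      unfolding L2_closed_span_def by blast
    let ?b = "\<lambda>x. \<Sum>i\<in>F. c i * b i x"
    let ?f = "\<lambda>x. \<Sum>i\<in>F. c i * f i x"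
    have 2: "?b \<in> L2_space M" "?f \<in> L2_space M"
      using F b f by (auto intro!: L2_space_sum L2_space_cmult)
    have "L2_norm M (\<lambda>x. g x - ?f x) \<le> L2_norm M (\<lambda>x. g x - ?b x) + L2_norm M (\<lambda>x. ?b x - ?f x)"
      using g 2 by (rule L2_norm_triangle_diff)
    also have "L2_norm M (\<lambda>x. ?b x - ?f x) = L2_norm M (\<lambda>x. \<Sum>i\<in>F. c i * (f i x - b i x))"
      by (subst L2_norm_minus_commute) (simp add: sum_subtractf right_diff_distrib)
    also have "\<dots> \<le> q * L2_norm M ?b"
      using F by (rule close)
    also have "q * L2_norm M ?b \<le> q * (L2_norm M g + \<epsilon> / 2)"
    proof (rule mult_left_mono[OF _ q(1)])
      show "L2_norm M ?b \<le> L2_norm M g + \<epsilon> / 2"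
        using L2_norm_triangle_sub[OF 2(1) g] gF L2_norm_minus_commute[of M g ?b] by simp
    qed
    finally have "L2_norm M (\<lambda>x. g x - ?f x) \<le> \<epsilon> / 2 + q * (L2_norm M g + \<epsilon> / 2)"
      using gF by simp
    also have "\<dots> \<le> q * L2_norm M g + \<epsilon>"
    proof -
      have "\<epsilon> * q \<le> \<epsilon>"
        using q \<open>0 < \<epsilon>\<close> by (intro mult_left_le) auto
      then show ?thesis by (simp add: algebra_simps)
    qed
    finally show ?thesis using F by blast
  qed
  have iterate: "\<exists>F c. finite F \<and> F \<subseteq> I \<and>
      L2_norm M (\<lambda>x. g x - (\<Sum>i\<in>F. c i * f i x)) \<le> q ^ k * L2_norm M g + \<epsilon>"
    if g: "g \<in> L2_space M" and "0 < \<epsilon>" for g k \<epsilon>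
    using \<open>0 < \<epsilon>\<close>
  proof (induction k arbitrary: \<epsilon>)
    case 0
    then show ?case by (intro exI[of _ "{}"]) auto
  next
    case (Suc k)
    \<comment> \<open>With this tolerance the error bound \<open>\<epsilon>\<close> reproduces itself: \<open>q * \<epsilon> + (1 - q) * \<epsilon> = \<epsilon>\<close>.\<close>
    have pos: "0 < (1 - q) * \<epsilon>"
      using q Suc.prems by simp
    obtain F c where F: "finite F" "F \<subseteq> I"
      and gF: "L2_norm M (\<lambda>x. g x - (\<Sum>i\<in>F. c i * f i x)) \<le> q ^ k * L2_norm M g + \<epsilon>"
      using Suc.IH[OF Suc.prems] by blast
    have r: "(\<lambda>x. g x - (\<Sum>i\<in>F. c i * f i x)) \<in> L2_space M"
      using g F f by (intro L2_space_diff L2_space_sum L2_space_cmult) auto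
    obtain G a where G: "finite G" "G \<subseteq> I"
      and gG: "L2_norm M (\<lambda>x. (g x - (\<Sum>i\<in>F. c i * f i x)) - (\<Sum>i\<in>G. a i * f i x))
          \<le> q * L2_norm M (\<lambda>x. g x - (\<Sum>i\<in>F. c i * f i x)) + (1 - q) * \<epsilon>"
      using step[OF r pos] by blast
    have "(\<lambda>x. (\<Sum>i\<in>F. c i * f i x) + (\<Sum>i\<in>G. a i * f i x)) \<in> finite_combs f I"
      using F G by (intro finite_combs_add finite_combsI)
    then obtain H d where H: "finite H" "H \<subseteq> I"
      and "\<And>x. (\<Sum>i\<in>H. d i * f i x) = (\<Sum>i\<in>F. c i * f i x) + (\<Sum>i\<in>G. a i * f i x)"
      unfolding finite_combs_def by (auto simp: fun_eq_iff)
    then have "L2_norm M (\<lambda>x. g x - (\<Sum>i\<in>H. d i * f i x))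
        \<le> q * L2_norm M (\<lambda>x. g x - (\<Sum>i\<in>F. c i * f i x)) + (1 - q) * \<epsilon>"
      using gG by (simp add: diff_diff_eq)
    also have "\<dots> \<le> q * (q ^ k * L2_norm M g + \<epsilon>) + (1 - q) * \<epsilon>"
      using q gF by (intro add_right_mono mult_left_mono)
    also have "\<dots> = q ^ Suc k * L2_norm M g + \<epsilon>"
      by (simp add: algebra_simps)
    finally show ?case using H by blast
  qed
  have "g \<in> L2_closed_span M f I" if g: "g \<in> L2_space M" for g
    unfolding L2_closed_span_def
  proof (intro CollectI conjI allI impI g)
    fix e :: real assume "0 < e"
    have "(\<lambda>k. q ^ k * L2_norm M g) \<longlonglongrightarrow> 0 * L2_norm M g"
      using q by (intro tendsto_intros LIMSEQ_power_zero) auto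
    then have "eventually (\<lambda>k. q ^ k * L2_norm M g < e / 2) sequentially"
      using \<open>0 < e\<close> by (intro order_tendstoD(2)[where a = "e / 2"]) auto
    then obtain k where k: "q ^ k * L2_norm M g < e / 2"
      by (auto simp: eventually_sequentially)
    obtain F c where "finite F" "F \<subseteq> I"
      "L2_norm M (\<lambda>x. g x - (\<Sum>i\<in>F. c i * f i x)) \<le> q ^ k * L2_norm M g + e / 2"
      using iterate[OF g half_gt_zero[OF \<open>0 < e\<close>]] by blast
    with k show "\<exists>F c. finite F \<and> F \<subseteq> I \<and> L2_norm M (\<lambda>x. g x - (\<Sum>i\<in>F. c i * f i x)) < e"
      by (intro exI[of _ F] exI[of _ c]) auto
  qed
  then show ?thesis
    by (auto simp: L2_closed_span_def)
qed

text \<open>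
  The Paley-Wiener stability criterion: the triangle inequality compares the norms of the finite
  sums \<open>\<Sum> c i * f i\<close> and \<open>\<Sum> c i * b i\<close> up to the factors \<open>1 - q\<close> and \<open>1 + q\<close>.
\<close>

theorem (in finite_measure) Paley_Wiener_stability:
  assumes I: "countable I"
    and f: "\<And>i. i \<in> I \<Longrightarrow> f i \<in> L2_space M" and b: "\<And>i. i \<in> I \<Longrightarrow> b i \<in> L2_space M"
    and span: "L2_closed_span M b I = L2_space M" and \<alpha>\<beta>: "0 < \<alpha>" "\<alpha> \<le> \<beta>"
    and lower: "\<And>F c. finite F \<Longrightarrow> F \<subseteq> I \<Longrightarrow>
        \<alpha> * (\<Sum>i\<in>F. (cmod (c i))\<^sup>2) \<le> (L2_norm M (\<lambda>x. \<Sum>i\<in>F. c i * b i x))\<^sup>2"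
    and upper: "\<And>F c. finite F \<Longrightarrow> F \<subseteq> I \<Longrightarrow>
        (L2_norm M (\<lambda>x. \<Sum>i\<in>F. c i * b i x))\<^sup>2 \<le> \<beta> * (\<Sum>i\<in>F. (cmod (c i))\<^sup>2)"
    and q: "0 \<le> q" "q < 1"
    and close: "\<And>F c. finite F \<Longrightarrow> F \<subseteq> I \<Longrightarrow>
        L2_norm M (\<lambda>x. \<Sum>i\<in>F. c i * (f i x - b i x)) \<le> q * L2_norm M (\<lambda>x. \<Sum>i\<in>F. c i * b i x)"
  shows "L2_Riesz_basis M f I"
proof (rule L2_Riesz_basis_of_finite_sums[OF I f])
  show "L2_closed_span M f I = L2_space M"
    by (rule L2_closed_span_perturbed[OF f b span q close])
  show "0 < (1 - q)\<^sup>2 * \<alpha>" 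
    using q \<alpha>\<beta> by simp
  have "(1 - q)\<^sup>2 \<le> (1 + q)\<^sup>2"
    using q by (intro power_mono) auto
  then show "(1 - q)\<^sup>2 * \<alpha> \<le> (1 + q)\<^sup>2 * \<beta>"
    using \<alpha>\<beta> by (intro mult_mono) auto
next
  fix F c assume F: "finite F" "F \<subseteq> I"
  let ?b = "\<lambda>x. \<Sum>i\<in>F. c i * b i x"
  let ?f = "\<lambda>x. \<Sum>i\<in>F. c i * f i x"
  have 2: "?b \<in> L2_space M" "?f \<in> L2_space M"
    using F b f by (auto intro!: L2_space_sum L2_space_cmult)
  have diff: "L2_norm M (\<lambda>x. ?f x - ?b x) \<le> q * L2_norm M ?b"
    using close[OF F, of c] by (simp add: sum_subtractf right_diff_distrib)
  have "(1 - q) * L2_norm M ?b \<le> L2_norm M ?f"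
    using L2_norm_triangle_sub[OF 2] L2_norm_minus_commute[of M ?b ?f] diff
    by (simp add: algebra_simps)
  then have "((1 - q) * L2_norm M ?b)\<^sup>2 \<le> (L2_norm M ?f)\<^sup>2"
    using q by (intro power_mono) auto
  moreover have "(1 - q)\<^sup>2 * (\<alpha> * (\<Sum>i\<in>F. (cmod (c i))\<^sup>2)) \<le> (1 - q)\<^sup>2 * (L2_norm M ?b)\<^sup>2"
    by (intro mult_left_mono lower F) auto
  ultimately show "(1 - q)\<^sup>2 * \<alpha> * (\<Sum>i\<in>F. (cmod (c i))\<^sup>2) \<le> (L2_norm M ?f)\<^sup>2"
    by (simp add: power_mult_distrib mult.assoc)
  have "L2_norm M ?f \<le> (1 + q) * L2_norm M ?b"
    using L2_norm_triangle_sub[OF 2(2) 2(1)] diff by (simp add: algebra_simps)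
  then have "(L2_norm M ?f)\<^sup>2 \<le> ((1 + q) * L2_norm M ?b)\<^sup>2"
    by (intro power_mono) auto
  moreover have "(1 + q)\<^sup>2 * (L2_norm M ?b)\<^sup>2 \<le> (1 + q)\<^sup>2 * (\<beta> * (\<Sum>i\<in>F. (cmod (c i))\<^sup>2))"
    by (intro mult_left_mono upper F) auto
  ultimately show "(L2_norm M ?f)\<^sup>2 \<le> (1 + q)\<^sup>2 * \<beta> * (\<Sum>i\<in>F. (cmod (c i))\<^sup>2)"
    by (simp add: power_mult_distrib mult.assoc)
qed

text \<open>
  If two indices carried the same vector, the coefficients 1 and -1 at these indices would give the sum 0,
  contradicting the lower Riesz bound.
\<close>

lemma L2_Riesz_basis_inj_on:
  assumes basis: "L2_Riesz_basis M (\<lambda>i. f (\<rho> i)) I"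
  shows "inj_on \<rho> I"
proof (rule inj_onI, rule ccontr)
  fix i j assume ij: "i \<in> I" "j \<in> I" "\<rho> i = \<rho> j" "i \<noteq> j"
  define c :: "_ \<Rightarrow> complex" where "c k = (if k = i then 1 else if k = j then -1 else 0)" for k
  have sum_c: "((\<lambda>k. (cmod (c k))\<^sup>2) has_sum 2) I"
  proof -
    have "((\<lambda>k. (cmod (c k))\<^sup>2) has_sum (\<Sum>k\<in>{i, j}. (cmod (c k))\<^sup>2)) {i, j}"
      by (intro has_sum_finite) auto
    also have "(\<Sum>k\<in>{i, j}. (cmod (c k))\<^sup>2) = 2"
      using ij by (simp add: c_def)
    also have "((\<lambda>k. (cmod (c k))\<^sup>2) has_sum 2) {i, j} \<longleftrightarrow> ((\<lambda>k. (cmod (c k))\<^sup>2) has_sum 2) I"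
      using ij by (intro has_sum_cong_neutral) (auto simp: c_def)
    finally show ?thesis .
  qed
  then obtain \<alpha> h where \<alpha>: "0 < \<alpha>" and h: "L2_has_sum M (\<lambda>k x. c k * f (\<rho> k) x) h I"
    and le: "\<alpha> * (\<Sum>\<^sub>\<infinity>k\<in>I. (cmod (c k))\<^sup>2) \<le> (L2_norm M h)\<^sup>2"
    using basis unfolding L2_Riesz_basis_def summable_on_def by blast
  have "(\<Sum>k\<in>F. c k * f (\<rho> k) x) = 0" if F: "finite F" "{i, j} \<subseteq> F" for F x
  proof -
    have "(\<Sum>k\<in>F. c k * f (\<rho> k) x) = (\<Sum>k\<in>{i, j}. c k * f (\<rho> k) x)"
      using F by (intro sum.mono_neutral_right) (auto simp: c_def)
    also have "\<dots> = 0"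
      using ij by (simp add: c_def)
    finally show ?thesis .
  qed
  then have "L2_norm M (\<lambda>x. (\<Sum>k\<in>F. c k * f (\<rho> k) x) - h x) = L2_norm M h"
    if "finite F" "{i, j} \<subseteq> F" for F
    using that by (simp add: L2_norm_def)
  then have "\<forall>\<^sub>F F in finite_subsets_at_top I.
      L2_norm M (\<lambda>x. (\<Sum>k\<in>F. c k * f (\<rho> k) x) - h x) = L2_norm M h"
    unfolding eventually_finite_subsets_at_top using ij by (intro exI[of _ "{i, j}"]) auto
  moreover have "((\<lambda>F. L2_norm M (\<lambda>x. (\<Sum>k\<in>F. c k * f (\<rho> k) x) - h x)) \<longlongrightarrow> 0) (finite_subsets_at_top I)"
    using h by (simp add: L2_has_sum_def)
  ultimately have "((\<lambda>F. L2_norm M h) \<longlongrightarrow> 0) (finite_subsets_at_top I)"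
    by (rule Lim_transform_eventually[rotated])
  then have "L2_norm M h = 0"
    by (simp add: tendsto_const_iff)
  with le \<alpha> infsumI[OF sum_c] show False by simp
qed

text \<open>
  A family indexed by \<open>I\<close> may be indexed by its set of labels instead, as the labels are
  automatically distinct.
\<close>

lemma L2_Riesz_basis_image:
  assumes basis: "L2_Riesz_basis M (\<lambda>i. f (\<rho> i)) I"
  shows "L2_Riesz_basis M f (\<rho> ` I)"
proof -
  have inj: "inj_on \<rho> I"
    by (rule L2_Riesz_basis_inj_on[where f = f, OF basis])
  have reindex: "(\<Sum>k\<in>\<rho> ` F. c k * f k x) = (\<Sum>i\<in>F. c (\<rho> i) * f (\<rho> i) x)"
    if "F \<subseteq> I" for F c x
    using that by (simp add: sum.reindex inj_on_subset[OF inj])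
  have "g \<in> L2_closed_span M f (\<rho> ` I)" if "g \<in> L2_space M" for g
  proof -
    have g: "g \<in> L2_closed_span M (\<lambda>i. f (\<rho> i)) I"
      using that basis by (simp add: L2_Riesz_basis_def)
    have "\<exists>F c. finite F \<and> F \<subseteq> \<rho> ` I \<and> L2_norm M (\<lambda>x. g x - (\<Sum>k\<in>F. c k * f k x)) < e"
      if "0 < e" for e
    proof -
      obtain F c where F: "finite F" "F \<subseteq> I"
        "L2_norm M (\<lambda>x. g x - (\<Sum>i\<in>F. c i * f (\<rho> i) x)) < e"
        using g \<open>0 < e\<close> unfolding L2_closed_span_def by blast
      have "(\<Sum>k\<in>\<rho> ` F. c (the_inv_into I \<rho> k) * f k x) = (\<Sum>i\<in>F. c i * f (\<rho> i) x)" for x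
        using F(2) by (subst reindex) (auto intro!: sum.cong simp: the_inv_into_f_f[OF inj] subset_iff)
      with F show ?thesis
        by (intro exI[of _ "\<rho> ` F"] exI[of _ "\<lambda>k. c (the_inv_into I \<rho> k)"]) auto
    qed
    with that show ?thesis by (simp add: L2_closed_span_def)
  qed
  then have span: "L2_closed_span M f (\<rho> ` I) = L2_space M"
    by (auto simp: L2_closed_span_def)
  have has_sum: "L2_has_sum M (\<lambda>k x. c k * f k x) h (\<rho> ` I)"
    if "L2_has_sum M (\<lambda>i x. c (\<rho> i) * f (\<rho> i) x) h I" for c h
  proof -
    have "((\<lambda>F. L2_norm M (\<lambda>x. (\<Sum>k\<in>\<rho> ` F. c k * f k x) - h x)) \<longlongrightarrow> 0) (finite_subsets_at_top I)"
    proof (rule Lim_transform_eventually)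
      show "((\<lambda>F. L2_norm M (\<lambda>x. (\<Sum>i\<in>F. c (\<rho> i) * f (\<rho> i) x) - h x)) \<longlongrightarrow> 0) (finite_subsets_at_top I)"
        using that by (simp add: L2_has_sum_def)
      show "\<forall>\<^sub>F F in finite_subsets_at_top I. L2_norm M (\<lambda>x. (\<Sum>i\<in>F. c (\<rho> i) * f (\<rho> i) x) - h x)
          = L2_norm M (\<lambda>x. (\<Sum>k\<in>\<rho> ` F. c k * f k x) - h x)"
        by (rule eventually_finite_subsets_at_top_weakI) (simp add: reindex)
    qed
    then show ?thesis
      using that
      by (simp add: L2_has_sum_def filterlim_filtermap flip: filtermap_image_finite_subsets_at_top[OF inj])
  qed
  obtain \<alpha> \<beta> where \<alpha>\<beta>: "0 < \<alpha>" "\<alpha> \<le> \<beta>"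
    and bounds: "\<And>c :: _ \<Rightarrow> complex. (\<lambda>i. (cmod (c i))\<^sup>2) summable_on I \<Longrightarrow>
           (\<exists>h. L2_has_sum M (\<lambda>i x. c i * f (\<rho> i) x) h I \<and>
              \<alpha> * (\<Sum>\<^sub>\<infinity>i\<in>I. (cmod (c i))\<^sup>2) \<le> (L2_norm M h)\<^sup>2 \<and>
              (L2_norm M h)\<^sup>2 \<le> \<beta> * (\<Sum>\<^sub>\<infinity>i\<in>I. (cmod (c i))\<^sup>2))"
    using basis unfolding L2_Riesz_basis_def by blast
  have "\<exists>h. L2_has_sum M (\<lambda>k x. c k * f k x) h (\<rho> ` I) \<and>
              \<alpha> * (\<Sum>\<^sub>\<infinity>k\<in>\<rho> ` I. (cmod (c k))\<^sup>2) \<le> (L2_norm M h)\<^sup>2 \<and>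
              (L2_norm M h)\<^sup>2 \<le> \<beta> * (\<Sum>\<^sub>\<infinity>k\<in>\<rho> ` I. (cmod (c k))\<^sup>2)"
    if "(\<lambda>k. (cmod (c k))\<^sup>2) summable_on \<rho> ` I" for c
    using bounds[of "\<lambda>i. c (\<rho> i)"] that has_sum
    by (auto simp: summable_on_reindex[OF inj] infsum_reindex[OF inj] o_def)
  moreover have "countable (\<rho> ` I)" "\<forall>k\<in>\<rho> ` I. f k \<in> L2_space M"
    using basis by (auto simp: L2_Riesz_basis_def)
  ultimately show ?thesis
    unfolding L2_Riesz_basis_def using span \<alpha>\<beta> by blast
qed

section \<open>Orthogonality of exponentials on a parallelepiped\<close>

lemma exponential_add_left: "exponential (\<gamma> + \<delta>) x = exponential \<gamma> x * exponential \<delta> x"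
  by (simp add: exponential_def inner_add_left ring_distribs exp_add)

lemma exponential_add_right: "exponential \<gamma> (x + y) = exponential \<gamma> x * exponential \<gamma> y"
  by (simp add: exponential_def inner_add_right ring_distribs exp_add)

lemma exponential_zero [simp]: "exponential 0 x = 1"
  by (simp add: exponential_def)

lemma exponential_eq_cis: "exponential \<gamma> x = cis (2 * pi * (\<gamma> \<bullet> x))"
  by (simp add: exponential_def cis_conv_exp mult_ac)

lemma cmod_exponential [simp]: "cmod (exponential \<gamma> x) = 1"
  by (simp add: exponential_eq_cis)

lemma cnj_exponential: "cnj (exponential \<gamma> x) = exponential (-\<gamma>) x"
  by (simp add: exponential_eq_cis cis_cnj)

lemma continuous_on_exponential [continuous_intros]:
  "continuous_on U f \<Longrightarrow> continuous_on U (\<lambda>x. exponential \<gamma> (f x))"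
  unfolding exponential_def by (intro continuous_intros)

lemma exponential_axis: "exponential (axis j (real_of_int k)) x = cis (2 * pi * k * x $ j)"
  by (simp add: exponential_eq_cis inner_axis' mult.assoc)

lemma int_lattice_add: "m \<in> int_lattice \<Longrightarrow> n \<in> int_lattice \<Longrightarrow> m + n \<in> int_lattice"
  by (simp add: int_lattice_def)

lemma int_lattice_diff: "m \<in> int_lattice \<Longrightarrow> n \<in> int_lattice \<Longrightarrow> m - n \<in> int_lattice"
  by (simp add: int_lattice_def)

lemma int_lattice_axis: "axis j (real_of_int k) \<in> int_lattice"
  by (simp add: int_lattice_def axis_def)

lemma int_lattice_zero: "0 \<in> int_lattice"
  by (simp add: int_lattice_def)

lemma countable_int_lattice: "countable (int_lattice :: (real ^ 'n) set)"
proof (rule countable_subset)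
  show "int_lattice \<subseteq> range (\<lambda>g :: 'n \<Rightarrow> int. \<chi> i. real_of_int (g i))"
  proof
    fix x :: "real ^ 'n" assume x: "x \<in> int_lattice"
    then have "x = (\<chi> i. real_of_int \<lfloor>x $ i\<rfloor>)"
      by (auto simp: int_lattice_def vec_eq_iff Ints_def)
    then show "x \<in> range (\<lambda>g :: 'n \<Rightarrow> int. \<chi> i. real_of_int (g i))"
      by (rule image_eqI[where x = "\<lambda>i. \<lfloor>x $ i\<rfloor>"]) simp
  qed
qed (intro countable_image, simp)

lemma integral_lborel_translation:
  fixes f :: "'a::euclidean_space \<Rightarrow> 'b::{banach, second_countable_topology}"
  assumes [measurable]: "f \<in> borel_measurable borel"
  shows "(\<integral>x. f (x + w) \<partial>lborel) = (\<integral>x. f x \<partial>lborel)"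
proof -
  have "(\<integral>x. f x \<partial>lborel) = (\<integral>x. f x \<partial>distr lborel borel ((+) w))"
    by (simp add: lborel_distr_plus)
  also have "\<dots> = (\<integral>x. f (w + x) \<partial>lborel)"
    by (subst integral_distr) auto
  finally show ?thesis by (simp add: add.commute)
qed

text \<open>
  The image \<open>S\<close> of the unit cube under \<open>A\<close>. The inverse \<open>B\<close> is a parameter because all the work is done
  in the coordinates \<open>B *v x\<close>.
\<close>

locale parallelepiped =
  fixes A B :: "real ^ 'n ^ 'n"
  assumes AB: "A ** B = mat 1" and BA: "B ** A = mat 1"
begin

definition S where "S = (*v) A ` cbox 0 1"

lemma A_B [simp]: "A *v (B *v x) = x"
  by (simp add: matrix_vector_mul_assoc AB)

lemma B_A [simp]: "B *v (A *v x) = x"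
  by (simp add: matrix_vector_mul_assoc BA)

lemma mem_S: "x \<in> S \<longleftrightarrow> (\<forall>j. 0 \<le> (B *v x) $ j \<and> (B *v x) $ j \<le> 1)"
proof -
  have "x \<in> S \<longleftrightarrow> B *v x \<in> cbox 0 1"
    by (auto simp: S_def intro!: image_eqI[of x "(*v) A" "B *v x"])
  then show ?thesis by (simp add: mem_box_cart)
qed

lemma compact_S: "compact S"
  unfolding S_def by (intro compact_continuous_image continuous_intros compact_cbox matrix_vector_mult_linear_continuous_on)

lemma S_lmeasurable: "S \<in> lmeasurable"
  using compact_S by (rule lmeasurable_compact)

lemma S_lebesgue [measurable]: "S \<in> sets lebesgue"
  using S_lmeasurable by (rule fmeasurableD)

lemma S_borel [measurable]: "S \<in> sets borel"
  using compact_S by (simp add: borel_compact)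

sublocale finite_measure "lebesgue_on S"
  using S_lmeasurable by (rule finite_measure_lebesgue_on)

lemma negligible_coordinate_hyperplane: "negligible {x. (B *v x) $ j = a}"
proof -
  have "B $ j \<noteq> 0"
  proof
    assume "B $ j = 0"
    then have "(B *v (A *v axis j 1)) $ j = 0"
      by (simp add: matrix_vector_mult_def)
    then show False by simp
  qed
  then have "negligible {x. B $ j \<bullet> x = a}"
    by (intro negligible_hyperplane) auto
  then show ?thesis
    by (simp add: matrix_vector_mul_component)
qed

lemma integral_S:
  fixes f :: "real ^ 'n \<Rightarrow> complex"
  assumes [measurable]: "f \<in> borel_measurable borel"
  shows "(\<integral>x. f x \<partial>lebesgue_on S) = (\<integral>x. indicator S x *\<^sub>R f x \<partial>lborel)"
  by (simp add: integral_restrict_space integral_completion)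

text \<open>
  Choose a coordinate \<open>i\<close> with \<open>n $ i \<noteq> 0\<close>. Moving \<open>x\<close> in the direction \<open>A *v axis i 1\<close> by
  \<open>t = 1/(2 |n $ i|)\<close> changes the sign of the character, and moving it by 1 changes nothing. The shifted
  half-open parallelepiped consists of an upper part \<open>U\<close> of the original one and of the lower slab \<open>L\<close>
  moved by one period, so the integral over it is the original integral. Hence the integral equals its
  own negative.
\<close>

lemma integral_exponential_zero:
  assumes n: "n \<in> int_lattice" "n \<noteq> 0"
  shows "(\<integral>x. exponential n (B *v x) \<partial>lebesgue_on S) = 0"
proof -
  obtain i where "n $ i \<noteq> 0"
    using n by (auto simp: vec_eq_iff)
  \<comment> \<open>The length of a shift by half a wave; it is at most 1/2 because \<open>n $ i\<close> is a nonzero integer.\<close>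
  define t where "t = 1 / (2 * \<bar>n $ i\<bar>)"
  have "1 \<le> \<bar>n $ i\<bar>"
    using n \<open>n $ i \<noteq> 0\<close> by (auto simp: int_lattice_def elim!: Ints_nonzero_abs_ge1)
  then have t: "0 < t" "t < 1"
    by (auto simp: t_def field_simps)
  define e where "e x = exponential n (B *v x)" for x
  define v where "v = A *v axis i 1"
  define w where "w = A *v axis i t"
  define P where "P = {x. \<forall>j. 0 \<le> (B *v x) $ j \<and> (B *v x) $ j < 1}"
  define L where "L = {x \<in> P. (B *v x) $ i < t}"
  define U where "U = {x \<in> P. t \<le> (B *v x) $ i}"
  have contB: "continuous_on UNIV (\<lambda>x. (B *v x) $ j)" for j
    by (intro continuous_intros matrix_vector_mult_linear_continuous_on)
  have [measurable]: "(\<lambda>x. (B *v x) $ j) \<in> borel_measurable borel" for j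
    using contB by (rule borel_measurable_continuous_onI)
  have [measurable]: "e \<in> borel_measurable borel"
    unfolding e_def
    by (intro borel_measurable_continuous_onI continuous_intros matrix_vector_mult_linear_continuous_on)
  have [measurable]: "P \<in> sets borel" "L \<in> sets borel" "U \<in> sets borel"
    unfolding L_def U_def P_def by measurable
  have e_add: "e (x + y) = e x * e y" for x y
    by (simp add: e_def matrix_vector_right_distrib exponential_add_right)
  have "e v = 1"
  proof -
    obtain k where "n $ i = of_int k"
      using n by (auto simp: int_lattice_def Ints_def)
    then show ?thesis
      by (simp add: e_def v_def exponential_eq_cis inner_axis)
  qed
  have "e w = -1"
  proof -
    have "n $ i * t = 1/2 \<or> n $ i * t = -(1/2)"
      using \<open>n $ i \<noteq> 0\<close> by (simp add: t_def abs_if)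
    then have "2 * pi * (n \<bullet> (B *v w)) = pi \<or> 2 * pi * (n \<bullet> (B *v w)) = - pi"
      by (auto simp: w_def inner_axis mult.assoc)
    moreover have "cis pi = -1" "cis (- pi) = -1"
      by (simp_all add: complex_eq_iff)
    ultimately show ?thesis
      unfolding e_def exponential_eq_cis by metis
  qed
  have P_S: "P \<subseteq> S"
    by (auto simp: P_def mem_S less_imp_le)
  have int_P: "integrable lborel (\<lambda>x. indicator Q x *\<^sub>R e x)" 
    if [measurable]: "Q \<in> sets borel" and K: "Q \<subseteq> K" "compact K" for Q K
  proof (rule Bochner_Integration.integrable_bound)
    show "integrable lborel (indicator K :: _ \<Rightarrow> real)"
      using K by (intro integrable_real_indicator emeasure_compact_finite) (auto intro: borel_compact)
    show "AE x in lborel. norm (indicator Q x *\<^sub>R e x) \<le> norm (indicator K x :: real)"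
      using K by (intro AE_I2) (auto simp: e_def indicator_def)
  qed measurable
  define J where "J = (\<integral>x. indicator P x *\<^sub>R e x \<partial>lborel)"
  have shift: "indicator P x *\<^sub>R e (x + w) = indicator U (x + w) *\<^sub>R e (x + w) 
     + indicator L (x + w - v) *\<^sub>R e (x + w)" for x
  proof -
    have "(B *v (x + w)) $ j = (B *v x) $ j + (if j = i then t else 0)" for j
      by (simp add: w_def matrix_vector_right_distrib axis_def)
    moreover have "(B *v (x + w - v)) $ j = (B *v x) $ j + (if j = i then t - 1 else 0)" for j
      by (simp add: w_def v_def matrix_vector_right_distrib matrix_vector_mult_diff_distrib axis_def)
    ultimately have "x + w \<in> U \<longleftrightarrow> x \<in> P \<and> (B *v x) $ i < 1 - t"
      "x + w - v \<in> L \<longleftrightarrow> x \<in> P \<and> 1 - t \<le> (B *v x) $ i"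
      using t unfolding U_def L_def P_def by (auto split: if_splits) (smt (verit))+
    then show ?thesis by (auto simp: indicator_def)
  qed
  have "- J = (\<integral>x. indicator P x *\<^sub>R e (x + w) \<partial>lborel)"
    by (simp add: J_def e_add \<open>e w = -1\<close>)
  also have "\<dots> = (\<integral>x. indicator U (x + w) *\<^sub>R e (x + w) 
     + indicator L (x + w - v) *\<^sub>R e (x + w) \<partial>lborel)"
    by (simp only: shift)
  also have "\<dots> = (\<integral>x. indicator U x *\<^sub>R e x + indicator L (x - v) *\<^sub>R e x \<partial>lborel)"
    by (rule integral_lborel_translation[where f = "\<lambda>x. indicator U x *\<^sub>R e x + indicator L (x - v) *\<^sub>R e x"])
      measurable
  also have "\<dots> = (\<integral>x. indicator U x *\<^sub>R e x \<partial>lborel) + (\<integral>x. indicator L (x - v) *\<^sub>R e x \<partial>lborel)"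
  proof (rule Bochner_Integration.integral_add)
    show "integrable lborel (\<lambda>x. indicator U x *\<^sub>R e x)"
      using P_S compact_S by (intro int_P[of U S]) (auto simp: U_def)
    show "integrable lborel (\<lambda>x. indicator L (x - v) *\<^sub>R e x)"
    proof -
      have "{x. x - v \<in> L} \<subseteq> (+) v ` S"
        using P_S by (auto simp: L_def image_iff intro!: bexI[of _ "x - v" for x])
      then have "integrable lborel (\<lambda>x. indicator {x. x - v \<in> L} x *\<^sub>R e x)"
        by (rule int_P[rotated]) (use compact_S in \<open>simp_all add: compact_translation\<close>)
      then show ?thesis by (simp add: indicator_def)
    qed
  qed
  also have "(\<integral>x. indicator L (x - v) *\<^sub>R e x \<partial>lborel) = (\<integral>x. indicator L x *\<^sub>R e x \<partial>lborel)"
    using integral_lborel_translation[of "\<lambda>x. indicator L (x - v) *\<^sub>R e x" v]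
    by (simp add: e_add \<open>e v = 1\<close>)
  also have "(\<integral>x. indicator U x *\<^sub>R e x \<partial>lborel) + (\<integral>x. indicator L x *\<^sub>R e x \<partial>lborel)
      = (\<integral>x. indicator U x *\<^sub>R e x + indicator L x *\<^sub>R e x \<partial>lborel)"
    using P_S compact_S by (intro Bochner_Integration.integral_add[symmetric] int_P[where K = S]) (auto simp: L_def U_def)
  also have "\<dots> = J"
    unfolding J_def by (intro Bochner_Integration.integral_cong) (auto simp: L_def U_def indicator_def)
  finally have "J = 0" by simp
  moreover have "(\<integral>x. indicator S x *\<^sub>R e x \<partial>lborel) = J"
    unfolding J_def
  proof (rule integral_cong_AE)
    \<comment> \<open>The closed and the half-open parallelepiped differ by a null set of faces.\<close>
    have "negligible (\<Union>j. {x. (B *v x) $ j = 1})"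
      by (intro negligible_Union) (auto simp: negligible_coordinate_hyperplane)
    then have "AE x in lebesgue. x \<notin> (\<Union>j. {x. (B *v x) $ j = 1})"
      by (intro AE_not_in) (simp add: negligible_iff_null_sets)
    then have "AE x in lborel. x \<notin> (\<Union>j. {x. (B *v x) $ j = 1})"
      by (simp add: AE_completion_iff)
    then show "AE x in lborel. indicator S x *\<^sub>R e x = indicator P x *\<^sub>R e x"
      by eventually_elim (auto simp: mem_S P_def indicator_def order.order_iff_strict)
  qed measurable
  ultimately show ?thesis
    using integral_S[of e] by (simp add: e_def)
qed

lemma exponential_L2 [intro]: "(\<lambda>x. exponential n (B *v x)) \<in> L2_space (lebesgue_on S)"
proof -
  have "continuous_on S (\<lambda>x. exponential n (B *v x))"
    by (intro continuous_intros matrix_vector_mult_linear_continuous_on)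
  then have "(\<lambda>x. exponential n (B *v x)) \<in> borel_measurable (lebesgue_on S)"
    by (rule continuous_imp_measurable_on_sets_lebesgue) measurable
  then show ?thesis by (simp add: L2_space_def)
qed

lemma measure_S_pos: "0 < measure lebesgue S"
proof -
  let ?U = "{x. \<forall>j. 0 < (B *v x) $ j \<and> (B *v x) $ j < 1}"
  have "open ((*v) B -` box 0 1)"
    by (intro open_vimage open_box matrix_vector_mult_linear_continuous_on)
  then have "open ?U"
    by (simp add: vimage_def mem_box_cart)
  moreover have "A *v (\<chi> i. 1/2) \<in> ?U"
    by simp
  ultimately have "\<not> negligible ?U"
    using open_not_negligible by blast
  moreover have "?U \<subseteq> S"
    by (auto simp: mem_S less_imp_le)
  ultimately have "\<not> negligible S"
    using negligible_subset by blast
  then show ?thesis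
    using S_lmeasurable by (simp add: zero_less_measure_iff negligible_iff_measure)
qed

lemma L2_norm_exponential_sum:
  assumes F: "finite F" "F \<subseteq> int_lattice"
  shows "(L2_norm (lebesgue_on S) (\<lambda>x. \<Sum>n\<in>F. c n * exponential n (B *v x)))\<^sup>2
       = measure lebesgue S * (\<Sum>n\<in>F. (cmod (c n))\<^sup>2)"
proof -
  let ?e = "\<lambda>n x. exponential n (B *v x)"
  let ?M = "lebesgue_on S"
  have square: "of_real ((cmod (\<Sum>n\<in>F. c n * ?e n x))\<^sup>2)
      = (\<Sum>m\<in>F. \<Sum>n\<in>F. (c m * cnj (c n)) * ?e (m - n) x)" for x
    unfolding complex_norm_square cnj_sum sum_product
    by (intro sum.cong refl) (simp add: cnj_exponential mult_ac flip: exponential_add_left)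
  have int: "integrable ?M (?e n)" for n
    by (rule L2_imp_L1(1)[OF exponential_L2])
  have "complex_of_real ((L2_norm ?M (\<lambda>x. \<Sum>n\<in>F. c n * ?e n x))\<^sup>2)
      = (\<integral>x. (\<Sum>m\<in>F. \<Sum>n\<in>F. (c m * cnj (c n)) * ?e (m - n) x) \<partial>?M)"
    unfolding L2_norm_squared integral_complex_of_real[symmetric] square ..
  also have "\<dots> = (\<Sum>m\<in>F. \<Sum>n\<in>F. (c m * cnj (c n)) * (\<integral>x. ?e (m - n) x \<partial>?M))"
    by (simp add: int)
  also have "\<dots> = (\<Sum>m\<in>F. \<Sum>n\<in>F. if n = m then (c m * cnj (c m)) * measure lebesgue S else 0)"
    using F
    by (intro sum.cong refl)
      (auto simp: integral_exponential_zero int_lattice_diff subset_iff measure_restrict_space scaleR_conv_of_real)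
  also have "\<dots> = of_real (measure lebesgue S * (\<Sum>n\<in>F. (cmod (c n))\<^sup>2))"
    using F by (simp add: complex_norm_square sum_distrib_left mult_ac del: of_real_power)
  finally show ?thesis
    unfolding of_real_eq_iff .
qed

end

section \<open>Completeness of the exponentials\<close>

text \<open>
  Radial projection onto the disc of radius \<open>k\<close>: it keeps continuous approximants of a bounded
  function uniformly bounded without destroying their convergence.
\<close>

definition clip :: "real \<Rightarrow> complex \<Rightarrow> complex" where
  "clip k z = (k / max k (cmod z)) *\<^sub>R z"

lemma cmod_clip_le: "0 < k \<Longrightarrow> cmod (clip k z) \<le> k"
  by (simp add: clip_def divide_le_eq max_def mult_left_mono)

lemma clip_eq: "0 < k \<Longrightarrow> cmod z \<le> k \<Longrightarrow> clip k z = z"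
  by (simp add: clip_def)

lemma continuous_on_clip: "0 < k \<Longrightarrow> continuous_on U f \<Longrightarrow> continuous_on U (\<lambda>x. clip k (f x))"
  unfolding clip_def by (intro continuous_intros) (auto simp: max_def)

context parallelepiped
begin

text \<open>
  A continuous function whose zeros are the points on the hyperplanes through the faces of \<open>S\<close>; on
  \<open>S\<close> these are exactly the boundary points. It serves both to cut functions off near the boundary and
  to express that they vanish there.
\<close>

definition boundary_fun where "boundary_fun x = (\<Prod>j\<in>UNIV. (B *v x) $ j * (1 - (B *v x) $ j))"

lemma continuous_on_boundary_fun: "continuous_on U boundary_fun"
  unfolding boundary_fun_def
  by (intro continuous_intros matrix_vector_mult_linear_continuous_on)

lemma boundary_fun_zero_iff: "boundary_fun x = 0 \<longleftrightarrow> (\<exists>j. (B *v x) $ j = 0 \<or> (B *v x) $ j = 1)"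
  by (auto simp: boundary_fun_def)

lemma negligible_boundary: "negligible {x. boundary_fun x = 0}"
proof -
  have "negligible (\<Union>j. {x. (B *v x) $ j = 0} \<union> {x. (B *v x) $ j = 1})"
    by (intro negligible_Union) (auto simp: negligible_coordinate_hyperplane)
  moreover have "{x. boundary_fun x = 0} = (\<Union>j. {x. (B *v x) $ j = 0} \<union> {x. (B *v x) $ j = 1})"
    by (auto simp: boundary_fun_zero_iff)
  ultimately show ?thesis by simp
qed

lemma continuous_L2:
  assumes "continuous_on S h"
  shows "h \<in> L2_space (lebesgue_on S)"
proof -
  have m: "h \<in> borel_measurable (lebesgue_on S)"
    using assms by (rule continuous_imp_measurable_on_sets_lebesgue) measurable
  have "compact (h ` S)"
    using assms compact_S by (rule compact_continuous_image)
  then obtain K where K: "\<And>x. x \<in> S \<Longrightarrow> cmod (h x) \<le> K"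
    using compact_imp_bounded bounded_iff by (metis imageI)
  show ?thesis
    by (rule L2_space_dominated[where f = "\<lambda>_. 1" and m = K]) (use m K in \<open>auto simp: L2_space_def\<close>)
qed

text \<open>
  A measurable function is a limit almost everywhere of continuous functions \<open>g n\<close>. After
  truncating \<open>f\<close> the \<open>g n\<close> can be clipped to a fixed radius and multiplied by cutoffs that increase to 1 off the
  boundary; since the boundary is a null set, dominated convergence applies.
\<close>

lemma L2_approx_continuous:
  assumes f: "f \<in> L2_space (lebesgue_on S)" and "0 < e"
  obtains h where "continuous_on UNIV h" "\<And>x. boundary_fun x = 0 \<Longrightarrow> h x = 0"
    "L2_norm (lebesgue_on S) (\<lambda>x. f x - h x) < e"
proof -
  obtain k0 :: nat and g0 where g0: "g0 \<in> L2_space (lebesgue_on S)" "\<And>x. cmod (g0 x) \<le> k0"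
    and fg0: "L2_norm (lebesgue_on S) (\<lambda>x. f x - g0 x) < e / 2"
    using L2_approx_bounded[OF f half_gt_zero[OF \<open>0 < e\<close>]] by blast
  define k where "k = real k0 + 1"
  have k: "0 < k" "cmod (g0 x) \<le> k" for x
    using g0(2)[of x] by (auto simp: k_def)
  have "g0 measurable_on S"
    using g0 by (simp add: measurable_on_iff_borel_measurable L2_space_def)
  then obtain N g where N: "negligible N" and g: "\<And>n::nat. continuous_on UNIV (g n)"
    and lim: "\<And>x. x \<notin> N \<Longrightarrow> (\<lambda>n. g n x) \<longlonglongrightarrow> (if x \<in> S then g0 x else 0)"
    unfolding measurable_on_def by blast
  define h where "h n x = min 1 (real n * \<bar>boundary_fun x\<bar>) *\<^sub>R clip k (g n x)" for n x
  have cont: "continuous_on UNIV (h n)" for n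
    unfolding h_def using g
    by (intro continuous_intros continuous_on_boundary_fun continuous_on_clip k) auto
  have h_le: "cmod (h n x) \<le> k" for n x
  proof -
    have "cmod (h n x) = min 1 (real n * \<bar>boundary_fun x\<bar>) * cmod (clip k (g n x))"
      by (simp add: h_def)
    also have "\<dots> \<le> 1 * k"
      using k(1) by (intro mult_mono cmod_clip_le) auto
    finally show ?thesis by simp
  qed
  have h2: "h n \<in> L2_space (lebesgue_on S)" for n
    by (rule continuous_L2, rule continuous_on_subset[OF cont]) simp
  have "(\<lambda>n. L2_norm (lebesgue_on S) (\<lambda>x. g0 x - h n x)) \<longlonglongrightarrow> 0"
  proof (rule L2_norm_dominated_convergence)
    show "(\<lambda>x. g0 x - h n x) \<in> borel_measurable (lebesgue_on S)" for n
      using L2_space_diff[OF g0(1) h2] by (rule L2_space_measurable)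
    show "AE x in lebesgue_on S. cmod (g0 x - h n x) \<le> 2 * k" for n
    proof (rule AE_I2)
      fix x
      show "cmod (g0 x - h n x) \<le> 2 * k"
        using norm_triangle_ineq4[of "g0 x" "h n x"] k(2)[of x] h_le[of n x] by linarith
    qed
    have "negligible (N \<union> {x. boundary_fun x = 0})"
      using N negligible_boundary by (rule negligible_Un)
    then have "AE x in lebesgue. x \<notin> N \<union> {x. boundary_fun x = 0}"
      by (intro AE_not_in) (simp add: negligible_iff_null_sets)
    then have "AE x in lebesgue. x \<in> S \<longrightarrow> (\<lambda>n. g0 x - h n x) \<longlonglongrightarrow> 0"
    proof (eventually_elim, intro impI)
      fix x assume x: "x \<notin> N \<union> {x. boundary_fun x = 0}" "x \<in> S"
      have "(\<lambda>n. clip k (g n x)) \<longlonglongrightarrow> clip k (g0 x)"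
      proof -
        have "continuous_on UNIV (clip k)"
          using continuous_on_clip[OF k(1) continuous_on_id] by simp
        then have "isCont (clip k) (g0 x)"
          by (simp add: continuous_on_eq_continuous_at)
        then show ?thesis
          using lim[of x] x by (intro isCont_tendsto_compose[of _ "clip k"]) auto
      qed
      moreover have "(\<lambda>n. min 1 (real n * \<bar>boundary_fun x\<bar>)) \<longlonglongrightarrow> 1"
      proof (rule tendsto_eventually)
        have "0 < \<bar>boundary_fun x\<bar>" using x by simp
        then show "\<forall>\<^sub>F n in sequentially. min 1 (real n * \<bar>boundary_fun x\<bar>) = 1"
          using eventually_ge_at_top[of "nat \<lceil>1 / \<bar>boundary_fun x\<bar>\<rceil>"]
          by (auto elim!: eventually_mono simp: nat_le_iff ceiling_le_iff divide_le_eq)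
      qed
      ultimately have "(\<lambda>n. g0 x - h n x) \<longlonglongrightarrow> g0 x - 1 *\<^sub>R clip k (g0 x)"
        unfolding h_def by (intro tendsto_intros)
      then show "(\<lambda>n. g0 x - h n x) \<longlonglongrightarrow> 0"
        using k by (simp add: clip_eq)
    qed
    then show "AE x in lebesgue_on S. (\<lambda>n. g0 x - h n x) \<longlonglongrightarrow> 0"
      by (simp add: AE_restrict_space_iff)
  qed simp
  then obtain n where n: "L2_norm (lebesgue_on S) (\<lambda>x. g0 x - h n x) < e / 2"
    using LIMSEQ_zero_ex_less \<open>0 < e\<close> half_gt_zero by blast
  have "L2_norm (lebesgue_on S) (\<lambda>x. f x - h n x) < e"
    using L2_norm_triangle_diff[OF f g0(1) h2[of n]] fg0 n by simp
  moreover have "h n x = 0" if "boundary_fun x = 0" for x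
    using that by (simp add: h_def)
  ultimately show ?thesis using that cont by blast
qed

abbreviation wave where "wave n x \<equiv> exponential n (B *v x)"

text \<open>
  The quotient map from \<open>S\<close> to the torus that identifies opposite faces.
\<close>

definition torus_map :: "real ^ 'n \<Rightarrow> complex ^ 'n" where
  "torus_map x = (\<chi> j. cis (2 * pi * (B *v x) $ j))"

lemma continuous_on_torus_map: "continuous_on U torus_map"
  unfolding torus_map_def
  by (intro continuous_intros matrix_vector_mult_linear_continuous_on)

lemma torus_map_eq_imp:
  assumes "x \<in> S" "y \<in> S" "torus_map x = torus_map y"
  shows "x = y \<or> boundary_fun x = 0 \<and> boundary_fun y = 0"
proof (cases "B *v x = B *v y")
  case True
  then show ?thesis by (metis A_B)
next
  case False
  then obtain j where j: "(B *v x) $ j \<noteq> (B *v y) $ j"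
    by (auto simp: vec_eq_iff)
  let ?a = "(B *v x) $ j" and ?b = "(B *v y) $ j"
  have "cis (2 * pi * ?a) = cis (2 * pi * ?b)"
    using assms(3) by (simp add: torus_map_def vec_eq_iff)
  then have "exp (\<i> * of_real (2 * pi * ?a)) = exp (\<i> * of_real (2 * pi * ?b))"
    by (simp only: cis_conv_exp)
  then obtain n :: int where "\<i> * of_real (2 * pi * ?a) = \<i> * of_real (2 * pi * ?b) + (of_int (2 * n) * pi) * \<i>"
    unfolding exp_eq by blast
  then have "2 * pi * ?a = 2 * pi * ?b + 2 * of_int n * pi"
    by (auto simp: complex_eq_iff)
  then have "2 * pi * (?a - ?b - of_int n) = 0"
    by (simp add: algebra_simps)
  then have n: "?a - ?b = of_int n" by simp
  have ab: "0 \<le> ?a" "?a \<le> 1" "0 \<le> ?b" "?b \<le> 1"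
    using assms by (auto simp: mem_S)
  then have "-1 \<le> n" "n \<le> 1" "n \<noteq> 0"
    using n j by linarith+
  then have "n = -1 \<or> n = 1" by linarith
  then have "(?a = 0 \<or> ?a = 1) \<and> (?b = 0 \<or> ?b = 1)"
    using n ab by (elim disjE) auto
  then show ?thesis unfolding boundary_fun_zero_iff by blast
qed

text \<open>
  A function that vanishes on the boundary takes equal values on identified points, so it descends
  to the torus. The descended function is continuous because \<open>S\<close> is compact, which makes the quotient
  map closed.
\<close>

lemma factor_through_torus:
  fixes h :: "real ^ 'n \<Rightarrow> real"
  assumes h: "continuous_on S h" "\<And>x. boundary_fun x = 0 \<Longrightarrow> h x = 0"
  obtains k where "continuous_on (torus_map ` S) k" "\<And>x. x \<in> S \<Longrightarrow> k (torus_map x) = h x"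
proof -
  define k where "k z = h (inv_into S torus_map z)" for z
  have k: "k (torus_map x) = h x" if "x \<in> S" for x
  proof -
    have "inv_into S torus_map (torus_map x) \<in> S"
      "torus_map (inv_into S torus_map (torus_map x)) = torus_map x"
      using that by (auto intro: inv_into_into f_inv_into_f)
    then show ?thesis
      unfolding k_def using torus_map_eq_imp[OF _ that] h(2) by metis
  qed
  have "closed (k -` C \<inter> torus_map ` S)" if "closed C" for C
  proof -
    have "k -` C \<inter> torus_map ` S = torus_map ` (S \<inter> h -` C)"
      using k by auto
    moreover have "closed (S \<inter> h -` C)"
      using h(1) compact_imp_closed[OF compact_S] that by (rule continuous_closed_preimage)
    then have "compact (S \<inter> h -` C)"
      using compact_Int_closed[OF compact_S, of "S \<inter> h -` C"] by (simp add: Int_absorb1)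
    then have "closed (torus_map ` (S \<inter> h -` C))"
      by (intro compact_imp_closed compact_continuous_image continuous_on_torus_map)
    ultimately show ?thesis by simp
  qed
  moreover have "closed (torus_map ` S)"
    by (intro compact_imp_closed compact_continuous_image continuous_on_torus_map compact_S)
  ultimately have "continuous_on (torus_map ` S) k"
    by (simp add: continuous_on_closed_vimage)
  with k that show ?thesis by blast
qed

lemma finite_combs_mult:
  assumes "p \<in> finite_combs wave int_lattice" "r \<in> finite_combs wave int_lattice"
  shows "(\<lambda>x. p x * r x) \<in> finite_combs wave int_lattice"
proof -
  obtain F c G a where F: "F \<subseteq> int_lattice" "p = (\<lambda>x. \<Sum>m\<in>F. c m * wave m x)"
    and G: "G \<subseteq> int_lattice" "r = (\<lambda>x. \<Sum>n\<in>G. a n * wave n x)"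
    using assms unfolding finite_combs_def by blast
  have "p x * r x = (\<Sum>m\<in>F. \<Sum>n\<in>G. (c m * a n) * wave (m + n) x)" for x
    unfolding F G sum_product by (intro sum.cong refl) (simp add: exponential_add_left mult_ac)
  moreover have "(\<lambda>x. \<Sum>m\<in>F. \<Sum>n\<in>G. (c m * a n) * wave (m + n) x) \<in> finite_combs wave int_lattice"
    using F G by (intro finite_combs_sum finite_combs_single[where f = wave] int_lattice_add) auto
  ultimately show ?thesis by simp
qed

text \<open>
  Stone-Weierstrass on the torus for the algebra of real functions that pull back to
  trigonometric polynomials. On \<open>S\<close> itself the trigonometric polynomials do not separate opposite
  faces, which is why the torus and the vanishing on the boundary are needed.
\<close>

lemma trig_approx_real:
  fixes h :: "real ^ 'n \<Rightarrow> real"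
  assumes h: "continuous_on S h" "\<And>x. boundary_fun x = 0 \<Longrightarrow> h x = 0" and "0 < \<epsilon>"
  obtains p where "p \<in> finite_combs wave int_lattice" "\<And>x. x \<in> S \<Longrightarrow> cmod (of_real (h x) - p x) < \<epsilon>"
proof -
  obtain k where k: "continuous_on (torus_map ` S) k" "\<And>x. x \<in> S \<Longrightarrow> k (torus_map x) = h x"
    using factor_through_torus[OF h] by blast
  define P where "P g \<longleftrightarrow> continuous_on (torus_map ` S) g \<and>
      (\<exists>p\<in>finite_combs wave int_lattice. \<forall>x. complex_of_real (g (torus_map x)) = p x)" for g
  have "\<exists>g. P g \<and> (\<forall>z\<in>torus_map ` S. \<bar>k z - g z\<bar> < \<epsilon>)"
  proof (rule Stone_Weierstrass_HOL[where P = P])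
    show "compact (torus_map ` S)"
      by (intro compact_continuous_image continuous_on_torus_map compact_S)
    show "P (\<lambda>_. c)" for c
      using finite_combs_single[OF int_lattice_zero, of "of_real c" wave] by (force simp: P_def)
    show "continuous_on (torus_map ` S) g" if "P g" for g
      using that by (simp add: P_def)
    show "P (\<lambda>x. f x + g x)" if fg: "P f \<and> P g" for f g
    proof -
      obtain p r where "p \<in> finite_combs wave int_lattice" "\<And>x. complex_of_real (f (torus_map x)) = p x"
        "r \<in> finite_combs wave int_lattice" "\<And>x. complex_of_real (g (torus_map x)) = r x"
        using fg unfolding P_def by blast
      then have "\<exists>s\<in>finite_combs wave int_lattice. \<forall>x. complex_of_real (f (torus_map x) + g (torus_map x)) = s x"
        by (intro bexI[of _ "\<lambda>x. p x + r x"] finite_combs_add) auto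
      with fg show ?thesis by (simp add: P_def continuous_on_add)
    qed
    show "P (\<lambda>x. f x * g x)" if fg: "P f \<and> P g" for f g
    proof -
      obtain p r where "p \<in> finite_combs wave int_lattice" "\<And>x. complex_of_real (f (torus_map x)) = p x"
        "r \<in> finite_combs wave int_lattice" "\<And>x. complex_of_real (g (torus_map x)) = r x"
        using fg unfolding P_def by blast
      then have "\<exists>s\<in>finite_combs wave int_lattice. \<forall>x. complex_of_real (f (torus_map x) * g (torus_map x)) = s x"
        by (intro bexI[of _ "\<lambda>x. p x * r x"] finite_combs_mult) auto
      with fg show ?thesis by (simp add: P_def continuous_on_mult)
    qed
    have Re: "P (\<lambda>z. Re (z $ j))" for j
      unfolding P_def
    proof (intro conjI continuous_intros bexI allI)
      show "complex_of_real (Re (torus_map x $ j))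
          = 1/2 * wave (axis j (real_of_int 1)) x + 1/2 * wave (axis j (real_of_int (-1))) x" for x
        unfolding exponential_axis by (simp add: torus_map_def complex_eq_iff)
    qed (intro finite_combs_add finite_combs_single[where f = wave] int_lattice_axis)
    have Im: "P (\<lambda>z. Im (z $ j))" for j
      unfolding P_def
    proof (intro conjI continuous_intros bexI allI)
      show "complex_of_real (Im (torus_map x $ j))
          = (-\<i>/2) * wave (axis j (real_of_int 1)) x + (\<i>/2) * wave (axis j (real_of_int (-1))) x" for x
        unfolding exponential_axis by (simp add: torus_map_def complex_eq_iff)
    qed (intro finite_combs_add finite_combs_single[where f = wave] int_lattice_axis)
    show "\<exists>g. P g \<and> g z \<noteq> g w" if zw: "z \<in> torus_map ` S \<and> w \<in> torus_map ` S \<and> z \<noteq> w" for z w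
    proof -
      obtain j where "z $ j \<noteq> w $ j"
        using zw by (auto simp: vec_eq_iff)
      then have "Re (z $ j) \<noteq> Re (w $ j) \<or> Im (z $ j) \<noteq> Im (w $ j)"
        by (simp add: complex_eq_iff)
      then show ?thesis
      proof
        assume "Re (z $ j) \<noteq> Re (w $ j)"
        with Re show ?thesis by (intro exI[of _ "\<lambda>z. Re (z $ j)"]) auto
      next
        assume "Im (z $ j) \<noteq> Im (w $ j)"
        with Im show ?thesis by (intro exI[of _ "\<lambda>z. Im (z $ j)"]) auto
      qed
    qed
  qed (use k \<open>0 < \<epsilon>\<close> in auto)
  then obtain g p where p: "p \<in> finite_combs wave int_lattice"
    and g: "\<And>x. complex_of_real (g (torus_map x)) = p x" "\<And>x. x \<in> S \<Longrightarrow> \<bar>h x - g (torus_map x)\<bar> < \<epsilon>"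
    using k(2) by (auto simp: P_def)
  have "cmod (of_real (h x) - p x) < \<epsilon>" if "x \<in> S" for x
    using g(2)[OF that] by (simp flip: g(1) of_real_diff)
  with p that show ?thesis by blast
qed

text \<open>
  The real and imaginary parts are approximated separately; the imaginary unit enters as a
  multiple of the constant character \<open>wave 0\<close>.
\<close>

lemma trig_approx:
  fixes h :: "real ^ 'n \<Rightarrow> complex"
  assumes h: "continuous_on S h" "\<And>x. boundary_fun x = 0 \<Longrightarrow> h x = 0" and "0 < \<epsilon>"
  obtains p where "p \<in> finite_combs wave int_lattice" "\<And>x. x \<in> S \<Longrightarrow> cmod (h x - p x) < \<epsilon>"
proof -
  obtain p where p: "p \<in> finite_combs wave int_lattice" "\<And>x. x \<in> S \<Longrightarrow> cmod (of_real (Re (h x)) - p x) < \<epsilon> / 2"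
    by (rule trig_approx_real[of "\<lambda>x. Re (h x)" "\<epsilon> / 2"]) (use h \<open>0 < \<epsilon>\<close> in \<open>auto intro!: continuous_intros\<close>)
  obtain r where r: "r \<in> finite_combs wave int_lattice" "\<And>x. x \<in> S \<Longrightarrow> cmod (of_real (Im (h x)) - r x) < \<epsilon> / 2"
    by (rule trig_approx_real[of "\<lambda>x. Im (h x)" "\<epsilon> / 2"]) (use h \<open>0 < \<epsilon>\<close> in \<open>auto intro!: continuous_intros\<close>)
  have "(\<lambda>x. \<i> * wave 0 x) \<in> finite_combs wave int_lattice"
    by (intro finite_combs_single[where f = wave] int_lattice_zero)
  then have "(\<lambda>x. p x + (\<i> * wave 0 x) * r x) \<in> finite_combs wave int_lattice"
    using finite_combs_add[OF p(1) finite_combs_mult[OF _ r(1)]] by blast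
  moreover have "cmod (h x - (p x + (\<i> * wave 0 x) * r x)) < \<epsilon>" if "x \<in> S" for x
  proof -
    have "h x - (p x + (\<i> * wave 0 x) * r x)
        = (of_real (Re (h x)) - p x) + \<i> * (of_real (Im (h x)) - r x)"
      by (subst complex_eq[of "h x"]) (simp add: algebra_simps)
    also have "cmod \<dots> \<le> cmod (of_real (Re (h x)) - p x) + cmod (of_real (Im (h x)) - r x)"
      using norm_triangle_ineq[of "of_real (Re (h x)) - p x" "\<i> * (of_real (Im (h x)) - r x)"]
      by (simp add: norm_mult)
    finally show ?thesis using p(2)[OF that] r(2)[OF that] by simp
  qed
  ultimately show ?thesis using that by blast
qed

lemma finite_combs_L2: "p \<in> finite_combs wave int_lattice \<Longrightarrow> p \<in> L2_space (lebesgue_on S)"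
  unfolding finite_combs_def by (auto intro!: L2_space_sum L2_space_cmult exponential_L2)

theorem exponentials_complete: "L2_closed_span (lebesgue_on S) wave int_lattice = L2_space (lebesgue_on S)"
proof -
  have "\<exists>p\<in>finite_combs wave int_lattice. L2_norm (lebesgue_on S) (\<lambda>x. f x - p x) < \<epsilon>"
    if f: "f \<in> L2_space (lebesgue_on S)" and "0 < \<epsilon>" for f \<epsilon>
  proof -
    obtain h where h: "continuous_on UNIV h" "\<And>x. boundary_fun x = 0 \<Longrightarrow> h x = 0"
      and fh: "L2_norm (lebesgue_on S) (\<lambda>x. f x - h x) < \<epsilon> / 2"
      using L2_approx_continuous[OF f half_gt_zero[OF \<open>0 < \<epsilon>\<close>]] by blast
    have hS: "continuous_on S h"
      using h(1) by (rule continuous_on_subset) simp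
    define s where "s = L2_norm (lebesgue_on S) (\<lambda>x. 1)"
    have "0 < \<epsilon> / (2 * (s + 1))"
      using \<open>0 < \<epsilon>\<close> by (simp add: s_def add_nonneg_pos)
    then obtain p where p: "p \<in> finite_combs wave int_lattice"
      "\<And>x. x \<in> S \<Longrightarrow> cmod (h x - p x) < \<epsilon> / (2 * (s + 1))"
      using trig_approx[OF hS h(2)] by blast
    have p2: "p \<in> L2_space (lebesgue_on S)" and h2: "h \<in> L2_space (lebesgue_on S)"
      using finite_combs_L2[OF p(1)] continuous_L2[OF hS] by auto
    have "L2_norm (lebesgue_on S) (\<lambda>x. h x - p x) \<le> \<epsilon> / (2 * (s + 1)) * s"
      unfolding s_def
      by (rule L2_norm_dominated)
        (use p(2) \<open>0 < \<epsilon>\<close> L2_space_measurable[OF L2_space_diff[OF h2 p2]] in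
          \<open>auto simp: L2_space_def s_def less_imp_le\<close>)
    also have "\<dots> \<le> \<epsilon> / 2"
    proof -
      have "0 \<le> s" by (simp add: s_def)
      then show ?thesis using \<open>0 < \<epsilon>\<close> by (simp add: field_simps)
    qed
    finally have "L2_norm (lebesgue_on S) (\<lambda>x. f x - p x) < \<epsilon>"
      using L2_norm_triangle_diff[OF f h2 p2] fh by simp
    with p show ?thesis by blast
  qed
  then show ?thesis by (auto simp: L2_closed_span_eq)
qed

end

section \<open>Perturbing the frequencies\<close>

text \<open>
  Induction on \<open>k\<close>: one factor \<open>\<delta> n \<bullet> y x\<close> is written as \<open>\<Sum>j. \<delta> n $ j * y x $ j\<close>. Multiplication by
  \<open>y x $ j\<close> costs a factor \<open>m\<close> in the \<open>L\<^sup>2\<close> norm, and replacing \<open>c n\<close> by \<open>c n * \<delta> n $ j\<close> costs a factor \<open>r\<close>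
  in the \<open>\<ell>\<^sup>2\<close> norm of the coefficients; the sum over \<open>j\<close> gives the factor \<open>CARD('n)\<close>. The induction hypothesis
  is needed for all coefficients.
\<close>

lemma frequency_perturbation_power:
  fixes \<delta> :: "'i \<Rightarrow> real ^ 'n" and y :: "'a \<Rightarrow> real ^ 'n" and b :: "'i \<Rightarrow> 'a \<Rightarrow> complex"
    and m r D :: real
  assumes b: "\<And>n. n \<in> F \<Longrightarrow> b n \<in> L2_space M" and "0 \<le> D"
    and upper: "\<And>c. L2_norm M (\<lambda>x. \<Sum>n\<in>F. c n * b n x) \<le> D * sqrt (\<Sum>n\<in>F. (cmod (c n))\<^sup>2)"
    and y: "\<And>j. (\<lambda>x. y x $ j) \<in> borel_measurable M" "\<And>x j. x \<in> space M \<Longrightarrow> \<bar>y x $ j\<bar> \<le> m"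
    and \<delta>: "\<And>n j. n \<in> F \<Longrightarrow> \<bar>\<delta> n $ j\<bar> \<le> r" and "0 \<le> r" "0 \<le> m"
  shows "(\<lambda>x. \<Sum>n\<in>F. c n * (of_real ((\<delta> n \<bullet> y x) ^ k) * b n x)) \<in> L2_space M
    \<and> L2_norm M (\<lambda>x. \<Sum>n\<in>F. c n * (of_real ((\<delta> n \<bullet> y x) ^ k) * b n x))
      \<le> (CARD('n) * r * m) ^ k * (D * sqrt (\<Sum>n\<in>F. (cmod (c n))\<^sup>2))"
proof (induction k arbitrary: c)
  case 0
  then show ?case using upper[of c] b by (auto intro!: L2_space_sum L2_space_cmult)
next
  case (Suc k)
  let ?s = "real CARD('n) * r * m"
  let ?T = "\<lambda>c x. \<Sum>n\<in>F. c n * (of_real ((\<delta> n \<bullet> y x) ^ k) * b n x)"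
  let ?c = "\<lambda>j n. c n * of_real (\<delta> n $ j)"
  let ?g = "\<lambda>j x. of_real (y x $ j) * ?T (?c j) x"
  have split: "(\<Sum>n\<in>F. c n * (of_real ((\<delta> n \<bullet> y x) ^ Suc k) * b n x)) = (\<Sum>j\<in>UNIV. ?g j x)" for x
  proof -
    have "(\<Sum>n\<in>F. c n * (of_real ((\<delta> n \<bullet> y x) ^ Suc k) * b n x))
        = (\<Sum>n\<in>F. \<Sum>j\<in>UNIV. of_real (y x $ j) * (?c j n * (of_real ((\<delta> n \<bullet> y x) ^ k) * b n x)))"
      by (intro sum.cong refl) (simp add: inner_vec_def sum_distrib_left sum_distrib_right mult_ac)
    also have "\<dots> = (\<Sum>j\<in>UNIV. ?g j x)"
      by (subst sum.swap) (simp add: sum_distrib_left)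
    finally show ?thesis .
  qed
  have g: "?g j \<in> L2_space M \<and>
      L2_norm M (?g j) \<le> m * r * (?s ^ k * (D * sqrt (\<Sum>n\<in>F. (cmod (c n))\<^sup>2)))" for j
  proof -
    have T2: "?T (?c j) \<in> L2_space M"
      using Suc.IH[of "?c j"] by blast
    have meas: "?g j \<in> borel_measurable M"
      using L2_space_measurable[OF T2] measurable_compose[OF y(1)[of j] borel_measurable_of_real]
      by (intro borel_measurable_times) simp_all
    have le: "cmod (?g j x) \<le> m * cmod (?T (?c j) x)" if "x \<in> space M" for x
      using y(2)[OF that, of j] by (simp add: norm_mult mult_right_mono)
    have "(\<Sum>n\<in>F. (cmod (?c j n))\<^sup>2) \<le> (\<Sum>n\<in>F. r\<^sup>2 * (cmod (c n))\<^sup>2)"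
    proof (rule sum_mono)
      fix n assume "n \<in> F"
      then have "\<bar>\<delta> n $ j\<bar>\<^sup>2 \<le> r\<^sup>2"
        by (intro power_mono \<delta>) auto
      then show "(cmod (?c j n))\<^sup>2 \<le> r\<^sup>2 * (cmod (c n))\<^sup>2"
        using mult_right_mono[of "\<bar>\<delta> n $ j\<bar>\<^sup>2" "r\<^sup>2" "(cmod (c n))\<^sup>2"]
        by (simp add: norm_mult power_mult_distrib mult.commute)
    qed
    then have "sqrt (\<Sum>n\<in>F. (cmod (?c j n))\<^sup>2) \<le> sqrt (r\<^sup>2 * (\<Sum>n\<in>F. (cmod (c n))\<^sup>2))"
      by (intro real_sqrt_le_mono) (simp add: sum_distrib_left)
    also have "\<dots> = r * sqrt (\<Sum>n\<in>F. (cmod (c n))\<^sup>2)"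
      using \<open>0 \<le> r\<close> by (simp add: real_sqrt_mult)
    finally have c_le: "sqrt (\<Sum>n\<in>F. (cmod (?c j n))\<^sup>2) \<le> r * sqrt (\<Sum>n\<in>F. (cmod (c n))\<^sup>2)" .
    have "L2_norm M (?g j) \<le> m * L2_norm M (?T (?c j))"
      using L2_norm_dominated[OF T2 meas \<open>0 \<le> m\<close> le] .
    also have "\<dots> \<le> m * (?s ^ k * (D * sqrt (\<Sum>n\<in>F. (cmod (?c j n))\<^sup>2)))"
      using Suc.IH[of "?c j"] \<open>0 \<le> m\<close> by (intro mult_left_mono) auto
    also have "\<dots> \<le> m * (?s ^ k * (D * (r * sqrt (\<Sum>n\<in>F. (cmod (c n))\<^sup>2))))"
      using c_le \<open>0 \<le> m\<close> \<open>0 \<le> r\<close> \<open>0 \<le> D\<close> by (intro mult_left_mono) auto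
    finally have "L2_norm M (?g j) \<le> m * r * (?s ^ k * (D * sqrt (\<Sum>n\<in>F. (cmod (c n))\<^sup>2)))"
      by (simp add: mult_ac)
    with L2_space_dominated[OF T2 meas le] show ?thesis by blast
  qed
  have "L2_norm M (\<lambda>x. \<Sum>j\<in>UNIV. ?g j x) \<le> (\<Sum>j\<in>(UNIV :: 'n set). L2_norm M (?g j))"
    using g by (intro L2_norm_sum) blast
  also have "\<dots> \<le> (\<Sum>j\<in>(UNIV :: 'n set). m * r * (?s ^ k * (D * sqrt (\<Sum>n\<in>F. (cmod (c n))\<^sup>2))))"
    using g by (intro sum_mono) blast
  also have "\<dots> = ?s ^ Suc k * (D * sqrt (\<Sum>n\<in>F. (cmod (c n))\<^sup>2))"
    by (simp add: mult_ac)
  finally have "L2_norm M (\<lambda>x. \<Sum>j\<in>UNIV. ?g j x) \<le> ?s ^ Suc k * (D * sqrt (\<Sum>n\<in>F. (cmod (c n))\<^sup>2))" .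
  moreover have "(\<lambda>x. \<Sum>j\<in>UNIV. ?g j x) \<in> L2_space M"
    using g by (intro L2_space_sum) blast
  ultimately show ?case
    unfolding split by blast
qed

lemma exp_minus_one_sums:
  fixes z :: "'a::{real_normed_field, banach}"
  shows "(\<lambda>k. z ^ Suc k / fact (Suc k)) sums (exp z - 1)"
proof -
  have "(\<lambda>k. z ^ k / fact k) sums exp z"
    using exp_converges[of z] by (simp add: scaleR_conv_of_real divide_inverse mult.commute)
  then show ?thesis
    by (subst sums_Suc_iff) simp
qed

text \<open>
  Summing the bounds for the powers over the exponential series. The partial sums converge pointwise
  and obey the bound uniformly, so the limit obeys it by Fatou's lemma.
\<close>

lemma frequency_perturbation:
  fixes \<delta> :: "'i \<Rightarrow> real ^ 'n" and y :: "'a \<Rightarrow> real ^ 'n" and b :: "'i \<Rightarrow> 'a \<Rightarrow> complex"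
    and m r D :: real
  assumes F: "finite F" and b: "\<And>n. n \<in> F \<Longrightarrow> b n \<in> L2_space M" and "0 \<le> D"
    and upper: "\<And>c. L2_norm M (\<lambda>x. \<Sum>n\<in>F. c n * b n x) \<le> D * sqrt (\<Sum>n\<in>F. (cmod (c n))\<^sup>2)"
    and y: "\<And>j. (\<lambda>x. y x $ j) \<in> borel_measurable M" "\<And>x j. x \<in> space M \<Longrightarrow> \<bar>y x $ j\<bar> \<le> m"
    and \<delta>: "\<And>n j. n \<in> F \<Longrightarrow> \<bar>\<delta> n $ j\<bar> \<le> r" and "0 \<le> r" "0 \<le> m"
  shows "L2_norm M (\<lambda>x. \<Sum>n\<in>F. c n * (b n x * (exponential (\<delta> n) (y x) - 1)))
      \<le> (exp (2 * pi * CARD('n) * r * m) - 1) * (D * sqrt (\<Sum>n\<in>F. (cmod (c n))\<^sup>2))"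
proof -
  let ?s = "CARD('n) * r * m"
  let ?N = "D * sqrt (\<Sum>n\<in>F. (cmod (c n))\<^sup>2)"
  let ?a = "\<lambda>k. (2 * of_real pi * \<i>) ^ Suc k / fact (Suc k) :: complex"
  let ?T = "\<lambda>k x. \<Sum>n\<in>F. c n * (of_real ((\<delta> n \<bullet> y x) ^ Suc k) * b n x)"
  have T: "?T k \<in> L2_space M" "L2_norm M (?T k) \<le> ?s ^ Suc k * ?N" for k
    using frequency_perturbation_power[OF b \<open>0 \<le> D\<close> upper y \<delta> \<open>0 \<le> r\<close> \<open>0 \<le> m\<close>,
        where c = c and k = "Suc k"] by auto
  let ?P = "\<lambda>K x. \<Sum>k<K. ?a k * ?T k x"
  let ?g = "\<lambda>x. \<Sum>n\<in>F. c n * (b n x * (exponential (\<delta> n) (y x) - 1))"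
  have P2: "?P K \<in> L2_space M" for K
    by (intro L2_space_sum L2_space_cmult[OF T(1)])
  have lim: "(\<lambda>K. ?P K x) \<longlonglongrightarrow> ?g x" for x
  proof -
    have "(\<lambda>k. ?a k * ?T k x) sums ?g x"
    proof -
      let ?z = "\<lambda>n. 2 * of_real pi * \<i> * of_real (\<delta> n \<bullet> y x) :: complex"
      have "(\<lambda>k. \<Sum>n\<in>F. c n * b n x * (?z n ^ Suc k / fact (Suc k)))
          sums (\<Sum>n\<in>F. c n * b n x * (exp (?z n) - 1))"
        by (intro sums_sum sums_mult exp_minus_one_sums)
      moreover have "(\<Sum>n\<in>F. c n * b n x * (?z n ^ Suc k / fact (Suc k))) = ?a k * ?T k x" for k
        unfolding sum_distrib_left power_mult_distrib of_real_power
        by (intro sum.cong refl) (simp only: times_divide_eq_left times_divide_eq_right mult_ac)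
      ultimately show ?thesis
        by (simp only: exponential_def mult.assoc)
    qed
    then show ?thesis by (simp add: sums_def)
  qed
  have P_le: "L2_norm M (?P K) \<le> (exp (2 * pi * CARD('n) * r * m) - 1) * ?N" for K
  proof -
    have "L2_norm M (?P K) \<le> (\<Sum>k<K. L2_norm M (\<lambda>x. ?a k * ?T k x))"
      by (intro L2_norm_sum L2_space_cmult[OF T(1)])
    also have "\<dots> \<le> (\<Sum>k<K. (2 * pi * ?s) ^ Suc k / fact (Suc k) * ?N)"
    proof (rule sum_mono)
      fix k
      have a: "cmod (?a k) = (2 * pi) ^ Suc k / fact (Suc k)"
        by (simp only: norm_divide norm_power norm_mult norm_fact) simp
      have "L2_norm M (\<lambda>x. ?a k * ?T k x) \<le> cmod (?a k) * (?s ^ Suc k * ?N)"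
        unfolding L2_norm_cmult by (intro mult_left_mono T) simp
      also have "\<dots> = (2 * pi * ?s) ^ Suc k / fact (Suc k) * ?N"
        unfolding a power_mult_distrib[of "2 * pi" ?s] by (simp only: times_divide_eq_left mult.assoc)
      finally show "L2_norm M (\<lambda>x. ?a k * ?T k x) \<le> (2 * pi * ?s) ^ Suc k / fact (Suc k) * ?N" .
    qed
    also have "\<dots> = (\<Sum>k<K. (2 * pi * ?s) ^ Suc k / fact (Suc k)) * ?N"
      by (simp only: sum_distrib_right)
    also have "\<dots> \<le> (exp (2 * pi * ?s) - 1) * ?N"
    proof (rule mult_right_mono)
      have sums: "(\<lambda>k. (2 * pi * ?s) ^ Suc k / fact (Suc k)) sums (exp (2 * pi * ?s) - 1)"
        by (rule exp_minus_one_sums)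
      show "(\<Sum>k<K. (2 * pi * ?s) ^ Suc k / fact (Suc k)) \<le> exp (2 * pi * ?s) - 1"
        unfolding sums_unique[OF sums]
        by (rule sum_le_suminf[OF sums_summable[OF sums]]) (use \<open>0 \<le> r\<close> \<open>0 \<le> m\<close> in auto)
      show "0 \<le> ?N"
        using \<open>0 \<le> D\<close> by (simp add: sum_nonneg)
    qed
    finally show ?thesis by (simp add: mult.assoc)
  qed
  have meas: "?g \<in> borel_measurable M"
    by (rule borel_measurable_LIMSEQ_metric[OF L2_space_measurable[OF P2] lim])
  show ?thesis
    by (rule L2_norm_limit_le(2)[OF P2 meas AE_I2[OF lim] P_le])
qed

lemma round_vec_error: "\<bar>(round_vec x - x) $ j\<bar> \<le> 1/2"
proof -
  have "(round_vec x - x) $ j = of_int \<lfloor>x $ j + 1/2\<rfloor> - x $ j"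
    by (simp add: round_vec_def)
  also have "\<bar>\<dots>\<bar> \<le> 1/2"
    using of_int_floor_le[of "x $ j + 1/2"] real_of_int_floor_add_one_gt[of "x $ j + 1/2"]
    by (intro abs_leI) linarith+
  finally show ?thesis .
qed

context parallelepiped
begin

definition center where "center = A *v (\<chi> i. 1/2)"

lemma abs_minus_center_le:
  assumes "x \<in> S"
  shows "\<bar>(x - center) $ j\<bar> \<le> onorm ((*v) A) * (sqrt CARD('n) / 2)"
proof -
  define u where "u = B *v x - (\<chi> i. 1/2)"
  have u: "\<bar>u $ i\<bar> \<le> 1/2" for i
    using assms unfolding mem_S u_def by (simp add: abs_le_iff) (smt (verit) field_sum_of_halves)
  have "norm u = sqrt (\<Sum>i\<in>UNIV. (u $ i)\<^sup>2)"
    by (simp add: norm_vec_def L2_set_def)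
  also have "\<dots> \<le> sqrt (\<Sum>i\<in>(UNIV :: 'n set). (1/2)\<^sup>2)"
  proof (intro real_sqrt_le_mono sum_mono)
    show "(u $ i)\<^sup>2 \<le> (1/2)\<^sup>2" for i
      using power_mono[OF u[of i] abs_ge_zero, of 2] by simp
  qed
  also have "\<dots> = sqrt CARD('n) / 2"
    by (simp add: real_sqrt_divide power2_eq_square)
  finally have norm_u: "norm u \<le> sqrt CARD('n) / 2" .
  have "x - center = A *v u"
    by (simp add: u_def center_def matrix_vector_mult_diff_distrib)
  then have "\<bar>(x - center) $ j\<bar> \<le> norm (A *v u)"
    using component_le_norm_cart by metis
  also have "\<dots> \<le> onorm ((*v) A) * norm u"
    by (rule onorm[OF matrix_vector_mul_bounded_linear])
  also have "\<dots> \<le> onorm ((*v) A) * (sqrt CARD('n) / 2)"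
    by (intro mult_left_mono norm_u onorm_pos_le matrix_vector_mul_bounded_linear)
  finally show ?thesis .
qed

text \<open>
  The comparison system is \<open>b n = u n * wave n\<close>, the orthogonal system with the constant phases \<open>u n\<close>
  that arise from moving the origin to the centre of \<open>S\<close>. The phases change neither norms of sums, up
  to unimodular changes of the coefficients, nor the span.
\<close>

theorem rounded_exponentials_Riesz_basis:
  assumes small: "onorm ((*v) A) < 2 * ln 2 / (pi * real CARD('n) powr (3/2))"
  shows "L2_Riesz_basis (lebesgue_on S) (\<lambda>n. exponential (round_vec (transpose B *v n))) int_lattice"
proof -
  let ?M = "lebesgue_on S"
  define f where "f n = exponential (round_vec (transpose B *v n))" for n
  define \<delta> where "\<delta> n = round_vec (transpose B *v n) - transpose B *v n" for n
  define u where "u n = exponential (\<delta> n) center" for n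
  define b where "b n x = u n * wave n x" for n x
  define m where "m = onorm ((*v) A) * (sqrt CARD('n) / 2)"
  define q where "q = exp (2 * pi * CARD('n) * (1/2) * m) - 1"
  define D where "D = measure lebesgue S"
  have "0 < D" unfolding D_def by (rule measure_S_pos)
  have u_unit: "cmod (u n) = 1" for n by (simp add: u_def)
  have u_nz: "u n \<noteq> 0" for n
    using u_unit[of n] by auto
  have f_eq: "f n x = b n x * exponential (\<delta> n) (x - center)" for n x
  proof -
    have "exponential (transpose B *v n) x = wave n x"
      by (simp add: exponential_def dot_lmul_matrix)
    moreover have "f n x = exponential (transpose B *v n) x * exponential (\<delta> n) (center + (x - center))"
      by (simp add: f_def \<delta>_def flip: exponential_add_left)
    ultimately show ?thesis
      unfolding exponential_add_right by (simp add: b_def u_def mult_ac)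
  qed
  have b2: "b n \<in> L2_space ?M" for n
    unfolding b_def by (intro L2_space_cmult exponential_L2)
  have f2: "f n \<in> L2_space ?M" for n
    unfolding f_def by (intro continuous_L2 continuous_intros)
  have norm_b: "(L2_norm ?M (\<lambda>x. \<Sum>n\<in>F. c n * b n x))\<^sup>2 = D * (\<Sum>n\<in>F. (cmod (c n))\<^sup>2)"
    if "finite F" "F \<subseteq> int_lattice" for F c
    using L2_norm_exponential_sum[OF that, of "\<lambda>n. c n * u n"]
    by (simp add: b_def D_def norm_mult u_unit mult.assoc)
  have norm_b': "L2_norm ?M (\<lambda>x. \<Sum>n\<in>F. c n * b n x) = sqrt D * sqrt (\<Sum>n\<in>F. (cmod (c n))\<^sup>2)"
    if "finite F" "F \<subseteq> int_lattice" for F c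
  proof -
    have "L2_norm ?M (\<lambda>x. \<Sum>n\<in>F. c n * b n x) = sqrt ((L2_norm ?M (\<lambda>x. \<Sum>n\<in>F. c n * b n x))\<^sup>2)"
      by simp
    also have "\<dots> = sqrt D * sqrt (\<Sum>n\<in>F. (cmod (c n))\<^sup>2)"
      by (simp only: norm_b[OF that] real_sqrt_mult)
    finally show ?thesis .
  qed
  have "0 \<le> m"
    unfolding m_def by (intro mult_nonneg_nonneg onorm_pos_le matrix_vector_mul_bounded_linear) auto
  have "0 \<le> q"
    using \<open>0 \<le> m\<close> by (simp add: q_def)
  have "q < 1"
  proof -
    have "real CARD('n) powr (3/2) = real CARD('n) * sqrt CARD('n)"
      using powr_add[of "real CARD('n)" 1 "1/2"] by (simp add: powr_half_sqrt)
    then have "onorm ((*v) A) * (pi * (real CARD('n) * sqrt CARD('n))) < 2 * ln 2"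
      using small by (simp add: pos_less_divide_eq)
    then have "2 * pi * CARD('n) * (1/2) * m < ln 2"
      by (simp add: m_def mult_ac)
    then have "exp (2 * pi * CARD('n) * (1/2) * m) < exp (ln 2)"
      by (simp only: exp_less_mono)
    then show ?thesis by (simp add: q_def)
  qed
  have span: "L2_closed_span ?M b int_lattice = L2_space ?M"
  proof -
    have "finite_combs wave int_lattice \<subseteq> finite_combs b int_lattice"
    proof
      fix p assume "p \<in> finite_combs wave int_lattice"
      then obtain F c where F: "finite F" "F \<subseteq> int_lattice" "p = (\<lambda>x. \<Sum>n\<in>F. c n * wave n x)"
        unfolding finite_combs_def by blast
      have "p = (\<lambda>x. \<Sum>n\<in>F. (c n / u n) * b n x)"
        unfolding F b_def by (intro ext sum.cong refl) (simp add: u_nz)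
      then show "p \<in> finite_combs b int_lattice"
        using finite_combsI[OF F(1,2), of "\<lambda>n. c n / u n" b] by simp
    qed
    then have "L2_closed_span ?M wave int_lattice \<subseteq> L2_closed_span ?M b int_lattice"
      unfolding L2_closed_span_eq by blast
    then show ?thesis
      unfolding exponentials_complete by (auto simp: L2_closed_span_def)
  qed
  have close: "L2_norm ?M (\<lambda>x. \<Sum>n\<in>F. c n * (f n x - b n x)) \<le> q * L2_norm ?M (\<lambda>x. \<Sum>n\<in>F. c n * b n x)"
    if F: "finite F" "F \<subseteq> int_lattice" for F c
  proof -
    have meas: "(\<lambda>x. (x - center) $ j) \<in> borel_measurable ?M" for j
      by (intro continuous_imp_measurable_on_sets_lebesgue continuous_intros S_lebesgue)
    have "L2_norm ?M (\<lambda>x. \<Sum>n\<in>F. c n * (b n x * (exponential (\<delta> n) (x - center) - 1)))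
        \<le> q * (sqrt D * sqrt (\<Sum>n\<in>F. (cmod (c n))\<^sup>2))"
      unfolding q_def
    proof (rule frequency_perturbation[OF F(1) b2])
      show "\<bar>(x - center) $ j\<bar> \<le> m" if "x \<in> space ?M" for x j
        using that abs_minus_center_le by (simp add: m_def)
      show "\<bar>\<delta> n $ j\<bar> \<le> 1/2" for n j
        unfolding \<delta>_def by (rule round_vec_error)
    qed (use meas \<open>0 < D\<close> \<open>0 \<le> m\<close> norm_b'[OF F] in auto)
    then show ?thesis
      unfolding norm_b'[OF F] by (simp add: f_eq right_diff_distrib)
  qed
  have "L2_Riesz_basis ?M f int_lattice"
    by (rule Paley_Wiener_stability[where b = b and \<alpha> = D and \<beta> = D and q = q])
      (use countable_int_lattice f2 b2 span \<open>0 < D\<close> norm_b \<open>0 \<le> q\<close> \<open>q < 1\<close> close in auto)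
  then show ?thesis
    by (simp add: f_def[abs_def])
qed

end

theorem theorem4:
  fixes A :: "real ^ 'n ^ 'n"
  assumes "invertible A"
    and "onorm ((*v) A) < 2 * ln 2 / (pi * real CARD('n) powr (3/2))"
  defines "C \<equiv> round_vec ` ((*v) (transpose (matrix_inv A)) ` int_lattice)"
  shows "L2_Riesz_basis (lebesgue_on ((*v) A ` cbox 0 1)) exponential C"
proof -
  interpret parallelepiped A "matrix_inv A"
  proof -
    have "A ** matrix_inv A = mat 1 \<and> matrix_inv A ** A = mat 1"
      using assms(1) unfolding invertible_def matrix_inv_def by (rule someI_ex)
    then show "parallelepiped A (matrix_inv A)"
      by (simp add: parallelepiped_def)
  qed
  have "L2_Riesz_basis (lebesgue_on S) exponential
      ((\<lambda>n. round_vec (transpose (matrix_inv A) *v n)) ` int_lattice)"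
    by (rule L2_Riesz_basis_image[where f = exponential, OF rounded_exponentials_Riesz_basis[OF assms(2)]])
  then show ?thesis
    by (simp add: S_def C_def image_image)
qed

end
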